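(* Let $\nu>-1/2$, $n\in\mathbb{N}_0$, and let $P_n(x)=\sum_{k=0}^na_{n,k}x^k$, $a_{n,n}>0$, be the polynomials orthonormal with respect to $\rho_\nu^2$ on $(0,\infty)$: $\int_0^\infty P_m(x)P_n(x)\rho_\nu^2(x)\,dx=\delta_{n,m}$. Then $P_n$ satisfies the Rodrigues-type formula $$P_n(x)=-\frac{a_{n,0}}{D_n\,\rho_\nu(x)}\sum_{r=0}^nD_{n,r}\,r!\,(1+\nu)_r\sum_{k=0}^{2r}\frac1{k!}\,\frac{d^k}{dx^k}\left(x^k\rho_\nu(x)\right)\,{}_3F_2\left(-k,\,1+\nu+r,\,1+r;\;1+\nu,\,1;\;1\right),\qquad x>0,$$ where $D_n$, $D_{n,r}$ are the determinants defined in the context and $$a_{n,0}=\pm\,D_n\left[D_{n,n}\,S_n\right]^{-1/2},\qquad S_n=\sqrt\pi\,\frac{\Gamma(1+2\nu)\Gamma(1+\nu)}{2^{1+2\nu}\Gamma(\nu+3/2)}\sum_{k=0}^nD_{n,k}\,(n+k)!\,\frac{(1+2\nu)_{n+k}(1+\nu)_{n+k}}{4^{n+k}(\nu+3/2)_{n+k}},$$ the sign being the one for which $a_{n,n}>0$.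
   Context: For $x>0$, $\rho_\nu(x)=2x^{\nu/2}K_\nu(2\sqrt x)$, with $K_\nu$ the Macdonald function (modified Bessel function of the second kind). $(a)_k$ is the Pochhammer symbol, ${}_3F_2$ the generalized hypergeometric function (here a terminating sum), $L_r^\nu$ the generalized Laguerre polynomials, $\Gamma(a,z)=\int_z^\infty e^{-u}u^{a-1}du$ the incomplete gamma function, and $\theta\{f\}(t)=t\frac{d}{dt}(tf(t))$. For integers $k,m,r\ge0$ put $$c_{k,r}=\frac{r!}{\Gamma(1+\nu+r)}\int_0^\infty t^\nu e^{-t}L_r^\nu(t)\,\theta^k\left(t^\nu e^t\Gamma(-\nu,t)\right)dt,\qquad d_{m,r}=\int_0^\infty t^{\nu+m}e^{-t}L_m^\nu(t)L_r^\nu(t)\,dt,$$ $$f_{k,m}=\sum_{r=0}^{2m}c_{k,r}\,d_{m,r}.$$ For $n\ge1$, $D_n$ is the determinant of the $n\times n$ matrix whose row $m$ ($m=0,\dots,n-1$) is $(f_{1,m},f_{2,m},\dots,f_{n,m})$. For $1\le k\le n$, $D_{n,k}$ is the determinant obtained from $D_n$ by replacing its $k$-th column $(f_{k,m})_{m=0}^{n-1}$ by the column $(f_{0,m})_{m=0}^{n-1}$. Also $D_{n,0}=-D_n$. For $n=0$ use the conventions $D_0=1$, $D_{0,0}=-1$. *)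

theory Defs
  imports "HOL-Analysis.Analysis" "Jordan_Normal_Form.Determinant"
begin

(* K_nu(z) = int_0^oo exp (-z cosh u) cosh (nu u) du: the standard integral representation,
   valid for z > 0 and every real nu (integer orders need no limit). *)
definition macdonald_K :: "real \<Rightarrow> real \<Rightarrow> real" where
  "macdonald_K \<nu> z = (LBINT u:{0<..}. exp (- z * cosh u) * cosh (\<nu> * u))"

definition rho :: "real \<Rightarrow> real \<Rightarrow> real" where
  "rho \<nu> x = 2 * x powr (\<nu> / 2) * macdonald_K \<nu> (2 * sqrt x)"

definition inc_Gamma :: "real \<Rightarrow> real \<Rightarrow> real" where
  "inc_Gamma a z = (LBINT u:{z<..}. exp (- u) * u powr (a - 1))"

definition laguerre :: "real \<Rightarrow> nat \<Rightarrow> real \<Rightarrow> real" where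
  "laguerre \<nu> r t = (\<Sum>i\<le>r. (-1) ^ i * ((of_nat r + \<nu>) gchoose (r - i)) * t ^ i / fact i)"

(* Numerator parameters as, denominator parameters bs. If some element of as is a nonpositive
   integer, all but finitely many terms vanish. *)
definition hypergeometric_F :: "real list \<Rightarrow> real list \<Rightarrow> real \<Rightarrow> real" where
  "hypergeometric_F as bs z =
     (\<Sum>j. prod_list (map (\<lambda>a. pochhammer a j) as) /
          prod_list (map (\<lambda>b. pochhammer b j) bs) * z ^ j / fact j)"

definition theta :: "(real \<Rightarrow> real) \<Rightarrow> real \<Rightarrow> real" where
  "theta f t = t * deriv (\<lambda>s. s * f s) t"

definition coef_c :: "real \<Rightarrow> nat \<Rightarrow> nat \<Rightarrow> real" where
  "coef_c \<nu> k r = fact r / Gamma (1 + \<nu> + of_nat r) *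
     (LBINT t:{0<..}. t powr \<nu> * exp (- t) * laguerre \<nu> r t *
        (theta ^^ k) (\<lambda>s. s powr \<nu> * exp s * inc_Gamma (- \<nu>) s) t)"

definition coef_d :: "real \<Rightarrow> nat \<Rightarrow> nat \<Rightarrow> real" where
  "coef_d \<nu> m r =
     (LBINT t:{0<..}. t powr (\<nu> + of_nat m) * exp (- t) * laguerre \<nu> m t * laguerre \<nu> r t)"

definition coef_f :: "real \<Rightarrow> nat \<Rightarrow> nat \<Rightarrow> real" where
  "coef_f \<nu> k m = (\<Sum>r\<le>2 * m. coef_c \<nu> k r * coef_d \<nu> m r)"

(* Indices of matrices start at 0, so the column (f_{k,m})_m has index k - 1. The names are
   qualified because HOL-Analysis has constants mat, vec and det of its own. *)
definition f_matrix :: "real \<Rightarrow> nat \<Rightarrow> real Matrix.mat" where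
  "f_matrix \<nu> n = Matrix.mat n n (\<lambda>(m, j). coef_f \<nu> (Suc j) m)"

definition det_D :: "real \<Rightarrow> nat \<Rightarrow> real" where
  "det_D \<nu> n = Determinant.det (f_matrix \<nu> n)"

definition det_Dk :: "real \<Rightarrow> nat \<Rightarrow> nat \<Rightarrow> real" where
  "det_Dk \<nu> n k =
     (if k = 0 then - det_D \<nu> n
      else Determinant.det
             (replace_col (f_matrix \<nu> n) (Matrix.vec n (\<lambda>m. coef_f \<nu> 0 m)) (k - 1)))"

lemma det_D_0: "det_D \<nu> 0 = 1"
  by (simp add: det_D_def f_matrix_def)

lemma det_Dk_0_0: "det_Dk \<nu> 0 0 = -1"
  by (simp add: det_Dk_def det_D_0)

definition norm_S :: "real \<Rightarrow> nat \<Rightarrow> real" where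
  "norm_S \<nu> n =
     sqrt pi * (Gamma (1 + 2 * \<nu>) * Gamma (1 + \<nu>) / (2 powr (1 + 2 * \<nu>) * Gamma (\<nu> + 3 / 2))) *
     (\<Sum>k\<le>n. det_Dk \<nu> n k * fact (n + k) *
        (pochhammer (1 + 2 * \<nu>) (n + k) * pochhammer (1 + \<nu>) (n + k) /
         (4 ^ (n + k) * pochhammer (\<nu> + 3 / 2) (n + k))))"

end

theory Submission
  imports Defs
begin

text \<open>
  Put \<open>\<phi> t = t powr \<nu> * exp t * inc_Gamma (- \<nu>) t\<close>. The functions \<open>\<theta>\<^sup>k \<phi>\<close> are Stieltjes-type integrals
  \<open>k! t\<^sup>k / \<Gamma>(1 + \<nu>) * (\<integral>u. u powr (\<nu> + k) * exp (- u) / (t + u) ^ (k + 1))\<close>, so their moments against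
  \<open>t powr \<nu> * exp (- t)\<close> are explicit Gamma quotients. Orthogonality of the Laguerre polynomials turns
  \<open>f\<^sub>k\<^sub>,\<^sub>m\<close> into the moment of \<open>t\<^sup>m L\<^sub>m\<close>, and Rodrigues' formula for \<open>L\<^sub>m\<close> reduces that to
  \<open>f\<^sub>k\<^sub>,\<^sub>m = (- 1)\<^sup>m / (m! \<Gamma>(1 + \<nu>)) * \<mu>\<^sub>k\<^sub>+\<^sub>m\<close> with \<open>\<mu>\<^sub>j\<close> the moments of \<open>rho\<^sup>2\<close>. Orthogonality of
  \<open>P\<^sub>n\<close> is therefore a linear system with matrix \<open>f\<^sub>k\<^sub>,\<^sub>m\<close>, solved by Cramer's rule; it is regular because
  \<open>x * rho\<^sup>2\<close> is a positive weight. Finally \<open>x\<^sup>r rho\<close> is the claimed combination of the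
  \<open>D\<^sup>k (x\<^sup>k rho) / k!\<close>, which are binomial coefficients in \<open>\<vartheta> = x D\<close>: it is Newton's interpolation
  formula for the polynomial \<open>(\<nu> - \<vartheta>)\<^sub>r (- \<vartheta>)\<^sub>r\<close>, whose value on \<open>rho\<close> is \<open>x\<^sup>r rho\<close> by the Bessel equation.
\<close>

section \<open>Integrals over the half-line\<close>

text \<open>Integrability and value are bundled in one relation, because the bare integral of a
  non-integrable function defaults to 0.\<close>

definition has_halfline_integral :: "(real \<Rightarrow> real) \<Rightarrow> real \<Rightarrow> bool"
    (infixr "has'_halfline'_integral" 46) where
  "f has_halfline_integral v \<longleftrightarrow>
     has_bochner_integral lborel (\<lambda>t. indicator {0<..} t *\<^sub>R f t) v"

lemma has_halfline_integral_iff: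
  "f has_halfline_integral v \<longleftrightarrow>
     set_integrable lborel {0<..} f \<and> (LBINT t:{0<..}. f t) = v"
  by (simp add: has_halfline_integral_def has_bochner_integral_iff set_integrable_def
      set_lebesgue_integral_def)

lemma halfline_integral_eq: "f has_halfline_integral v \<Longrightarrow> (LBINT t:{0<..}. f t) = v"
  by (simp add: has_halfline_integral_iff)

lemma halfline_integral_cong:
  assumes "\<And>t. t > 0 \<Longrightarrow> f t = g t"
  shows "(f has_halfline_integral v) \<longleftrightarrow> (g has_halfline_integral v)"
  unfolding has_halfline_integral_def
  by (intro has_bochner_integral_cong) (auto simp: indicator_def assms)

lemma halfline_integral_transform:
  assumes "f has_halfline_integral v" "\<And>t. t > 0 \<Longrightarrow> f t = g t" "v = w"
  shows "g has_halfline_integral w"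
  using assms halfline_integral_cong by blast

lemma halfline_integral_unique:
  "f has_halfline_integral v \<Longrightarrow> f has_halfline_integral w \<Longrightarrow> v = w"
  by (simp add: has_halfline_integral_iff)

lemma halfline_integral_cmult:
  assumes "f has_halfline_integral v"
  shows "(\<lambda>t. c * f t) has_halfline_integral c * v"
  using has_bochner_integral_mult_right[of c, OF assms[unfolded has_halfline_integral_def]]
  by (simp add: has_halfline_integral_def algebra_simps)

lemma halfline_integral_sum:
  assumes "\<And>i. i \<in> I \<Longrightarrow> f i has_halfline_integral v i"
  shows "(\<lambda>t. \<Sum>i\<in>I. f i t) has_halfline_integral (\<Sum>i\<in>I. v i)"
  using has_bochner_integral_sum[of I lborel "\<lambda>i t. indicator {0<..} t *\<^sub>R f i t" v] assms
  by (simp add: has_halfline_integral_def sum_distrib_left)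

section \<open>Positivity, substitution and interchange of integrals\<close>

lemma halfline_integral_nonneg:
  assumes "f has_halfline_integral v" "\<And>t. t > 0 \<Longrightarrow> 0 \<le> f t"
  shows "0 \<le> v"
  using assms unfolding has_halfline_integral_def has_bochner_integral_iff
  by (auto simp: indicator_def intro!: Bochner_Integration.integral_nonneg)

text \<open>If the integral were 0, the nonnegative integrand would vanish almost everywhere; since
  its zero set is finite, the interval from 0 to 1 would be a null set.\<close>

lemma halfline_integral_pos:
  assumes f: "f has_halfline_integral v" and nonneg: "\<And>t. t > 0 \<Longrightarrow> 0 \<le> f t"
    and fin: "finite {t. t > 0 \<and> f t = 0}"
  shows "0 < v"
proof (rule ccontr)
  let ?g = "\<lambda>t. indicator {0<..} t *\<^sub>R f t"
  assume "\<not> 0 < v"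
  then have v: "v = 0" using halfline_integral_nonneg[OF f nonneg] by simp
  have "AE t in lborel. ?g t = 0"
    using f v nonneg unfolding has_halfline_integral_def has_bochner_integral_iff
    by (intro integral_nonneg_eq_0_iff_AE[THEN iffD1]) (auto simp: indicator_def)
  moreover have "AE t in lborel. t \<notin> {t. t > 0 \<and> f t = 0}"
    by (rule AE_not_in, rule finite_imp_null_set_lborel[OF fin])
  ultimately have "AE t in lborel. t \<notin> {0<..(1::real)}"
    by eventually_elim (auto simp: indicator_def)
  moreover have greaterThanAtMost_eq: "{x. 0 < x \<and> x \<le> 1} = {0<..(1::real)}" by auto
  ultimately have "emeasure lborel {0<..(1::real)} = 0"
    by (subst (asm) AE_iff_measurable[OF _ refl]) (auto simp: greaterThanAtMost_eq)
  then show False by simp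
qed

lemma halfline_integral_scale:
  assumes "f has_halfline_integral v" and "s > 0"
  shows "(\<lambda>t. f (s * t)) has_halfline_integral v / s"
proof -
  have "has_bochner_integral lborel (\<lambda>x. indicator {0<..} (0 + s * x) *\<^sub>R f (0 + s * x)) (v /\<^sub>R \<bar>s\<bar>)"
    using assms unfolding has_halfline_integral_def
    by (intro lborel_has_bochner_integral_real_affine_iff[THEN iffD1, rotated]) auto
  then show ?thesis using assms(2)
    unfolding has_halfline_integral_def
    by (auto elim!: has_bochner_integral_cong[THEN iffD1, rotated -1]
      simp: indicator_def zero_less_mult_iff divide_inverse mult.commute)
qed

text \<open>Tonelli for nonnegative kernels: finiteness of one iterated integral carries over to the
  other. The closed forms below arise by writing one factor as a Gamma integral and
  interchanging.\<close>

lemma halfline_integral_swap: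
  fixes F :: "real \<Rightarrow> real \<Rightarrow> real"
  assumes F[measurable]: "(\<lambda>(x, y). F x y) \<in> borel_measurable (borel \<Otimes>\<^sub>M borel)"
    and nonneg: "\<And>x y. x > 0 \<Longrightarrow> y > 0 \<Longrightarrow> 0 \<le> F x y"
    and g: "\<And>x. x > 0 \<Longrightarrow> F x has_halfline_integral g x"
    and v: "g has_halfline_integral v"
    and h: "\<And>y. y > 0 \<Longrightarrow> (\<lambda>x. F x y) has_halfline_integral h y"
  shows "h has_halfline_integral v"
proof -
  let ?I = "indicator {0<..} :: real \<Rightarrow> real"
  let ?F = "\<lambda>x y. ?I x * ?I y * F x y"
  have Fm[measurable]: "(\<lambda>(x, y). ?F x y) \<in> borel_measurable (borel \<Otimes>\<^sub>M borel)"
    by measurable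
  have g0: "0 \<le> g x" if "x > 0" for x using halfline_integral_nonneg[OF g] nonneg that by blast
  have h0: "0 \<le> h y" if "y > 0" for y using halfline_integral_nonneg[OF h] nonneg that by blast
  \<comment> \<open>Identifying \<open>h\<close> with a parameter integral supplies its
    measurability, which is not assumed.\<close>
  have hI: "?I y * h y = (\<integral>x. ?F x y \<partial>lborel)" for y
    using h[of y] by (cases "y > 0")
      (auto simp: has_halfline_integral_def has_bochner_integral_iff indicator_def)
  have hm: "(\<lambda>y. ?I y * h y) \<in> borel_measurable lborel"
    unfolding hI by measurable
  have gx: "(\<integral>\<^sup>+y. ?F x y \<partial>lborel) = ennreal (?I x * g x)" for x
  proof (cases "x > 0")
    case True
    have "(\<integral>\<^sup>+y. ennreal (?I y *\<^sub>R F x y) \<partial>lborel) = ennreal (g x)"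
      using g[OF True] nonneg[OF True] unfolding has_halfline_integral_def
      by (subst nn_integral_eq_integral) (auto simp: has_bochner_integral_iff indicator_def)
    then show ?thesis using True by simp
  qed simp
  have hy: "(\<integral>\<^sup>+x. ?F x y \<partial>lborel) = ennreal (?I y * h y)" for y
  proof (cases "y > 0")
    case True
    have "(\<integral>\<^sup>+x. ennreal (?I x *\<^sub>R F x y) \<partial>lborel) = ennreal (h y)"
      using h[OF True] nonneg[OF _ True] unfolding has_halfline_integral_def
      by (subst nn_integral_eq_integral) (auto simp: has_bochner_integral_iff indicator_def)
    then show ?thesis using True by simp
  qed simp
  have v0: "0 \<le> v" using halfline_integral_nonneg[OF v] g0 by blast
  have "(\<integral>\<^sup>+y. ennreal (?I y * h y) \<partial>lborel) = (\<integral>\<^sup>+x. ennreal (?I x * g x) \<partial>lborel)"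
    unfolding hy[symmetric] gx[symmetric] by (rule lborel_pair.Fubini') simp
  also have "\<dots> = ennreal v"
    using v g0 unfolding has_halfline_integral_def
    by (subst nn_integral_eq_integral) (auto simp: has_bochner_integral_iff indicator_def)
  finally show ?thesis using hm v0 h0 unfolding has_halfline_integral_def
    by (intro has_bochner_integral_nn_integral) (auto simp: indicator_def)
qed

lemma halfline_Gamma:
  assumes a: "a > 0" and s: "s > 0"
  shows "(\<lambda>t. t powr (a - 1) * exp (- (s * t))) has_halfline_integral Gamma a * s powr (- a)"
proof -
  have "(\<lambda>t. t powr (a - 1) * exp (- t)) has_halfline_integral Gamma a"
  proof -
    have "((\<lambda>t. t powr (a - 1) / exp t) has_integral Gamma a) {0<..}"
      using Gamma_integral_real[OF a] has_integral_Icc_iff_Ioo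
      by (subst has_integral_spike_set_eq[of _ "{0..}"])
         (auto intro: negligible_subset[OF negligible_sing[of "0::real"]])
    then have "(\<integral>\<^sup>+t. ennreal (t powr (a - 1) / exp t) * indicator {0<..} t \<partial>lborel) = ennreal (Gamma a)"
      by (intro nn_integral_has_integral_lebesgue') auto
    then have "(\<integral>\<^sup>+t. ennreal (indicator {0<..} t *\<^sub>R (t powr (a - 1) * exp (- t))) \<partial>lborel) =
        ennreal (Gamma a)"
      by (elim trans[rotated], intro nn_integral_cong) (simp add: indicator_def exp_minus field_simps)
    then show ?thesis unfolding has_halfline_integral_def using a
      by (intro has_bochner_integral_nn_integral) auto
  qed
  from halfline_integral_cmult[OF halfline_integral_scale[OF this s], of "s powr (1 - a)"]
  show ?thesis
    by (rule halfline_integral_transform)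
       (use s in \<open>auto simp: powr_mult powr_diff powr_minus field_simps\<close>)
qed

text \<open>Dominated convergence for the difference quotients, which the mean value theorem bounds
  by \<open>g\<close>.\<close>

lemma has_derivative_under_integral:
  fixes F F' :: "real \<Rightarrow> 'a \<Rightarrow> real"
  assumes x0: "a < x0" "x0 < b"
    and int: "\<And>x. a < x \<Longrightarrow> x < b \<Longrightarrow> integrable M (F x)"
    and der: "\<And>x t. a < x \<Longrightarrow> x < b \<Longrightarrow> t \<in> space M \<Longrightarrow>
                ((\<lambda>x. F x t) has_real_derivative F' x t) (at x)"
    and bound: "\<And>x t. a < x \<Longrightarrow> x < b \<Longrightarrow> t \<in> space M \<Longrightarrow> \<bar>F' x t\<bar> \<le> g t"
    and g: "integrable M g" and meas: "F' x0 \<in> borel_measurable M"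
  shows "((\<lambda>x. \<integral>t. F x t \<partial>M) has_real_derivative (\<integral>t. F' x0 t \<partial>M)) (at x0)"
  unfolding has_field_derivative_iff tendsto_at_iff_sequentially comp_def
proof (intro allI impI)
  fix X :: "nat \<Rightarrow> real"
  assume X: "\<forall>i. X i \<in> UNIV - {x0}" and lim: "X \<longlonglongrightarrow> x0"
  have "eventually (\<lambda>n. a < X n \<and> X n < b) sequentially"
    using order_tendstoD[OF lim] x0 by (auto intro: eventually_conj)
  then obtain N where N: "\<And>n. n \<ge> N \<Longrightarrow> a < X n \<and> X n < b"
    by (auto simp: eventually_sequentially)
  \<comment> \<open>The shift by \<open>N\<close> keeps the sequence between \<open>a\<close> and
    \<open>b\<close>, the only place where the bound on \<open>F'\<close> is available.\<close>
  define Q where "Q n t = (F (X (n + N)) t - F x0 t) / (X (n + N) - x0)" for n t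
  have XN: "a < X (n + N)" "X (n + N) < b" "X (n + N) \<noteq> x0" for n using N[of "n + N"] X by auto
  have "(\<lambda>n. \<integral>t. Q n t \<partial>M) \<longlonglongrightarrow> (\<integral>t. F' x0 t \<partial>M)"
  proof (rule integral_dominated_convergence[where w = g])
    show "Q n \<in> borel_measurable M" for n
      unfolding Q_def using int[OF XN(1,2)[of n]] int[OF x0] by measurable
    show "AE t in M. (\<lambda>n. Q n t) \<longlonglongrightarrow> F' x0 t"
    proof (rule AE_I2)
      fix t assume t: "t \<in> space M"
      have "(\<lambda>n. X (n + N)) \<longlonglongrightarrow> x0" using lim by (rule LIMSEQ_ignore_initial_segment)
      then show "(\<lambda>n. Q n t) \<longlonglongrightarrow> F' x0 t"
        using der[OF x0 t] XN(3)
        unfolding Q_def has_field_derivative_iff tendsto_at_iff_sequentially comp_def by auto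
    qed
    show "AE t in M. norm (Q n t) \<le> g t" for n
    proof (rule AE_I2)
      fix t assume t: "t \<in> space M"
      have "norm (F (X (n + N)) t - F x0 t) \<le> g t * norm (X (n + N) - x0)"
        by (rule field_differentiable_bound[of "{a<..<b}" "\<lambda>x. F x t" "\<lambda>x. F' x t"])
           (use der bound t XN x0 in \<open>auto intro: has_field_derivative_at_within\<close>)
      then show "norm (Q n t) \<le> g t" using XN(3)[of n]
        by (simp add: Q_def abs_divide divide_le_eq)
    qed
  qed (use g meas in auto)
  moreover have "(\<integral>t. Q n t \<partial>M) =
     ((\<integral>t. F (X (n + N)) t \<partial>M) - (\<integral>t. F x0 t \<partial>M)) / (X (n + N) - x0)" for n
    unfolding Q_def using int[OF XN(1,2)[of n]] int[OF x0] by simp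
  ultimately show "(\<lambda>i. ((\<integral>t. F (X i) t \<partial>M) - (\<integral>t. F x0 t \<partial>M)) / (X i - x0))
      \<longlonglongrightarrow> (\<integral>t. F' x0 t \<partial>M)"
    by (subst LIMSEQ_offset[of _ N]) auto
qed

lemma has_derivative_halfline_integral:
  fixes F F' :: "real \<Rightarrow> real \<Rightarrow> real"
  assumes x0: "a < x0" "x0 < b"
    and int: "\<And>x. a < x \<Longrightarrow> x < b \<Longrightarrow> F x has_halfline_integral I x"
    and der: "\<And>x t. a < x \<Longrightarrow> x < b \<Longrightarrow> t > 0 \<Longrightarrow>
                ((\<lambda>x. F x t) has_real_derivative F' x t) (at x)"
    and bound: "\<And>x t. a < x \<Longrightarrow> x < b \<Longrightarrow> t > 0 \<Longrightarrow> \<bar>F' x t\<bar> \<le> g t"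
    and g: "g has_halfline_integral v"
    and int': "F' x0 has_halfline_integral I'"
  shows "(I has_real_derivative I') (at x0)"
proof -
  let ?i = "indicator {0<..} :: real \<Rightarrow> real"
  have "((\<lambda>x. \<integral>t. ?i t *\<^sub>R F x t \<partial>lborel) has_real_derivative (\<integral>t. ?i t *\<^sub>R F' x0 t \<partial>lborel)) (at x0)"
    by (rule has_derivative_under_integral[OF x0, where g = "\<lambda>t. ?i t *\<^sub>R g t"])
       (use int g int' in \<open>auto simp: has_halfline_integral_def has_bochner_integral_iff
         indicator_def intro: der bound\<close>)
  moreover have "(\<integral>t. ?i t *\<^sub>R F' x0 t \<partial>lborel) = I'"
    using int' by (simp add: has_halfline_integral_def has_bochner_integral_iff)
  moreover have "(\<integral>t. ?i t *\<^sub>R F x t \<partial>lborel) = I x" if "x \<in> {a<..<b}" for x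
    using int[of x] that by (simp add: has_halfline_integral_def has_bochner_integral_iff)
  ultimately show ?thesis
    using x0 by (auto elim!: DERIV_cong_ev[OF refl _ refl, THEN iffD1, rotated -1]
        intro!: eventually_nhds_in_open[of "{a<..<b}", THEN eventually_mono])
qed

section \<open>Moments of the iterates of theta\<close>

text \<open>The substitution \<open>(1 + y) powr (- p) = (\<integral>z. z powr (p - 1) * exp (- z * (1 + y))) / Gamma p\<close>
  turns Beta-type integrals into iterated Gamma integrals.\<close>
lemma halfline_Beta:
  assumes c: "c > 0" and p: "p > c"
  shows "(\<lambda>y. y powr (c - 1) * (1 + y) powr (- p)) has_halfline_integral
           Gamma c * Gamma (p - c) / Gamma p"
proof -
  have G: "Gamma p > 0" using c p by simp
  have "(\<lambda>y. y powr (c - 1) * (Gamma p * (1 + y) powr (- p))) has_halfline_integral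
      (Gamma c * (Gamma (p - c) * 1 powr (- (p - c))))"
  proof (rule halfline_integral_swap[where
        F = "\<lambda>z y. y powr (c - 1) * (z powr (p - 1) * exp (- ((1 + y) * z)))"])
    fix z :: real assume z: "z > 0"
    show "(\<lambda>y. y powr (c - 1) * (z powr (p - 1) * exp (- ((1 + y) * z)))) has_halfline_integral
        Gamma c * (z powr (p - c - 1) * exp (- (1 * z)))"
      using halfline_integral_cmult[OF halfline_Gamma[OF c z], of "z powr (p - 1) * exp (- z)"]
      by (rule halfline_integral_transform)
         (use z in \<open>auto simp: algebra_simps exp_diff exp_minus exp_add powr_diff powr_minus powr_add field_simps\<close>)
  next
    show "(\<lambda>z. Gamma c * (z powr (p - c - 1) * exp (- (1 * z)))) has_halfline_integral
        Gamma c * (Gamma (p - c) * 1 powr (- (p - c)))"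
      using c p by (intro halfline_integral_cmult halfline_Gamma) auto
  next
    fix y :: real assume y: "y > 0"
    show "(\<lambda>z. y powr (c - 1) * (z powr (p - 1) * exp (- ((1 + y) * z)))) has_halfline_integral
        y powr (c - 1) * (Gamma p * (1 + y) powr (- p))"
      using c p y by (intro halfline_integral_cmult halfline_Gamma) auto
  qed auto
  from halfline_integral_cmult[OF this, of "1 / Gamma p"] show ?thesis
    by (rule halfline_integral_transform) (use G in auto)
qed

text \<open>For positive \<open>b\<close> and \<open>t\<close> this is
  \<open>t powr (b - c) * Gamma b\<close> times Tricomi's confluent hypergeometric function U(b, b -
  c + 1, t).\<close>

definition stieltjes_gamma :: "real \<Rightarrow> real \<Rightarrow> real \<Rightarrow> real" where
  "stieltjes_gamma b c t = (LBINT u:{0<..}. u powr (b - 1) * exp (- u) * (t + u) powr (- c))"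

lemma stieltjes_gamma_integral:
  assumes b: "b > 0" and c: "c \<ge> 0" and t: "t > 0"
  shows "(\<lambda>u. u powr (b - 1) * exp (- u) * (t + u) powr (- c)) has_halfline_integral
           stieltjes_gamma b c t"
proof -
  have "set_integrable lborel {0<..} (\<lambda>u. u powr (b - 1) * exp (- u) * (t + u) powr (- c))"
  proof (rule set_integrable_bound)
    show "set_integrable lborel {0<..} (\<lambda>u. t powr (- c) * (u powr (b - 1) * exp (- (1 * u))))"
      using halfline_integral_cmult[OF halfline_Gamma[OF b less_numeral_extra(1)], of "t powr (- c)"]
      by (simp add: has_halfline_integral_iff)
    show "AE u in lborel. u \<in> {0<..} \<longrightarrow>
        norm (u powr (b - 1) * exp (- u) * (t + u) powr (- c))
        \<le> norm (t powr (- c) * (u powr (b - 1) * exp (- (1 * u))))"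
    proof (intro AE_I2 impI)
      fix u :: real assume "u \<in> {0<..}"
      then have "(t + u) powr (- c) \<le> t powr (- c)"
        using c t by (intro powr_mono2') auto
      then show "norm (u powr (b - 1) * exp (- u) * (t + u) powr (- c))
        \<le> norm (t powr (- c) * (u powr (b - 1) * exp (- (1 * u))))"
        by (subst mult.commute[of "t powr (- c)"]) (simp add: mult_left_mono)
    qed
  qed (simp add: set_borel_measurable_def)
  then show ?thesis by (simp add: has_halfline_integral_iff stieltjes_gamma_def)
qed

text \<open>Writing \<open>(t + u) powr (- c)\<close> as a Gamma integral in \<open>y\<close>
  separates the variables: the integrals in \<open>u\<close> and \<open>t\<close> yield
  \<open>(1 + y) powr (- b)\<close> and \<open>(1 + y) powr (- a)\<close>, and a Beta integral in
  \<open>y\<close> remains, which converges because of \<open>abc\<close>.\<close>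

lemma stieltjes_gamma_Gamma_integral:
  assumes a: "a > 0" and b: "b > 0" and c: "c > 0" and abc: "a + b > c"
  shows "(\<lambda>t. t powr (a - 1) * exp (- t) * stieltjes_gamma b c t) has_halfline_integral
           Gamma a * Gamma b * Gamma (a + b - c) / Gamma (a + b)"
proof -
  have G: "Gamma c > 0" using c by simp
  have inner: "(\<lambda>y. Gamma b * (1 + y) powr (- b) * (y powr (c - 1) * exp (- (t * y))))
      has_halfline_integral Gamma c * stieltjes_gamma b c t" if t: "t > 0" for t
  proof (rule halfline_integral_swap[where
        F = "\<lambda>u y. u powr (b - 1) * exp (- ((1 + y) * u)) * (y powr (c - 1) * exp (- (t * y)))"])
    fix u :: real assume u: "u > 0"
    show "(\<lambda>y. u powr (b - 1) * exp (- ((1 + y) * u)) * (y powr (c - 1) * exp (- (t * y))))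
       has_halfline_integral Gamma c * (u powr (b - 1) * exp (- u) * (t + u) powr (- c))"
      using halfline_integral_cmult[OF halfline_Gamma[OF c, of "t + u"], of "u powr (b - 1) * exp (- u)"]
      by (rule halfline_integral_transform)
         (use u t in \<open>auto simp: algebra_simps exp_diff exp_minus exp_add field_simps\<close>)
  next
    show "(\<lambda>u. Gamma c * (u powr (b - 1) * exp (- u) * (t + u) powr (- c))) has_halfline_integral
      Gamma c * stieltjes_gamma b c t"
      using c t b by (intro halfline_integral_cmult stieltjes_gamma_integral) auto
  next
    fix y :: real assume y: "y > 0"
    show "(\<lambda>u. u powr (b - 1) * exp (- ((1 + y) * u)) * (y powr (c - 1) * exp (- (t * y))))
       has_halfline_integral Gamma b * (1 + y) powr (- b) * (y powr (c - 1) * exp (- (t * y)))"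
      using halfline_integral_cmult[OF halfline_Gamma[OF b, of "1 + y"], of "y powr (c - 1) * exp (- (t * y))"] y
      by (simp add: mult.commute)
  qed auto
  have "(\<lambda>t. t powr (a - 1) * exp (- t) * (Gamma c * stieltjes_gamma b c t)) has_halfline_integral
      Gamma a * Gamma b * (Gamma c * Gamma (a + b - c) / Gamma (a + b))"
  proof (rule halfline_integral_swap[where
        F = "\<lambda>y t. t powr (a - 1) * exp (- t) *
          (Gamma b * (1 + y) powr (- b) * (y powr (c - 1) * exp (- (t * y))))"])
    fix y :: real assume y: "y > 0"
    show "(\<lambda>t. t powr (a - 1) * exp (- t) *
          (Gamma b * (1 + y) powr (- b) * (y powr (c - 1) * exp (- (t * y)))))
       has_halfline_integral Gamma a * Gamma b * (y powr (c - 1) * (1 + y) powr (- (a + b)))"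
      using halfline_integral_cmult[OF halfline_Gamma[OF a, of "1 + y"],
          of "Gamma b * (1 + y) powr (- b) * y powr (c - 1)"]
      by (rule halfline_integral_transform)
         (use y in \<open>auto simp: algebra_simps exp_diff exp_minus exp_add powr_diff powr_minus fun_eq_iff
            field_simps powr_add\<close>)
  next
    show "(\<lambda>y. Gamma a * Gamma b * (y powr (c - 1) * (1 + y) powr (- (a + b)))) has_halfline_integral
      Gamma a * Gamma b * (Gamma c * Gamma (a + b - c) / Gamma (a + b))"
      using c abc by (intro halfline_integral_cmult halfline_Beta) auto
  next
    fix t :: real assume t: "t > 0"
    show "(\<lambda>y. t powr (a - 1) * exp (- t) *
          (Gamma b * (1 + y) powr (- b) * (y powr (c - 1) * exp (- (t * y)))))
       has_halfline_integral t powr (a - 1) * exp (- t) * (Gamma c * stieltjes_gamma b c t)"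
      using t by (intro halfline_integral_cmult inner)
  qed (use b in auto)
  from halfline_integral_cmult[OF this, of "1 / Gamma c"] show ?thesis
    by (rule halfline_integral_transform) (use G in auto)
qed

text \<open>Differentiation under the integral sign; near \<open>t\<close> the derivative of the
  integrand is dominated by its size at \<open>t / 2\<close>, since negative powers
  decrease.\<close>

lemma stieltjes_gamma_deriv:
  assumes b: "b > 0" and c: "c \<ge> 0" and t: "t > 0"
  shows "(stieltjes_gamma b c has_real_derivative - c * stieltjes_gamma b (c + 1) t) (at t)"
proof (rule has_derivative_halfline_integral[where a = "t / 2" and b = "2 * t" and
      F = "\<lambda>t u. u powr (b - 1) * exp (- u) * (t + u) powr (- c)" and
      F' = "\<lambda>t u. - c * (u powr (b - 1) * exp (- u) * (t + u) powr (- (c + 1)))" and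
      g = "\<lambda>u. c * (u powr (b - 1) * exp (- u) * (t / 2 + u) powr (- (c + 1)))"])
  show "(\<lambda>u. c * (u powr (b - 1) * exp (- u) * (t / 2 + u) powr (- (c + 1))))
      has_halfline_integral c * stieltjes_gamma b (c + 1) (t / 2)"
    using b c t by (intro halfline_integral_cmult stieltjes_gamma_integral) auto
  show "(\<lambda>u. - c * (u powr (b - 1) * exp (- u) * (t + u) powr (- (c + 1))))
      has_halfline_integral - c * stieltjes_gamma b (c + 1) t"
    using b c t by (intro halfline_integral_cmult stieltjes_gamma_integral) auto
next
  fix s u :: real assume s: "t / 2 < s" and u: "u > 0"
  have "((\<lambda>x. (x + u) powr (- c)) has_real_derivative - c * (s + u) powr (- c - 1)) (at s)"
    using s t u by (auto intro!: derivative_eq_intros)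
  moreover have "- c - 1 = - (c + 1)" by simp
  ultimately have "((\<lambda>x. (x + u) powr (- c)) has_real_derivative - c * (s + u) powr (- (c + 1))) (at s)"
    by (simp only:)
  from DERIV_cmult[OF this, of "u powr (b - 1) * exp (- u)"]
  show "((\<lambda>x. u powr (b - 1) * exp (- u) * (x + u) powr (- c)) has_real_derivative
      - c * (u powr (b - 1) * exp (- u) * (s + u) powr (- (c + 1)))) (at s)"
    by (simp add: mult_ac)
  have "(s + u) powr (- (c + 1)) \<le> (t / 2 + u) powr (- (c + 1))"
    using s t u c by (intro powr_mono2') auto
  then show "\<bar>- c * (u powr (b - 1) * exp (- u) * (s + u) powr (- (c + 1)))\<bar>
      \<le> c * (u powr (b - 1) * exp (- u) * (t / 2 + u) powr (- (c + 1)))"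
    using c by (simp add: abs_mult mult_left_mono)
qed (use t b c in \<open>auto intro!: stieltjes_gamma_integral\<close>)

text \<open>Under the integral this is \<open>(t + u) - t = u\<close>. It is the relation that lets
  \<open>theta\<close> raise both parameters at once.\<close>

lemma stieltjes_gamma_contiguous:
  assumes b: "b > 0" and c: "c \<ge> 0" and t: "t > 0"
  shows "stieltjes_gamma b c t - t * stieltjes_gamma b (c + 1) t = stieltjes_gamma (b + 1) (c + 1) t"
proof -
  have "(\<lambda>u. u powr (b + 1 - 1) * exp (- u) * (t + u) powr (- (c + 1)) +
        t * (u powr (b - 1) * exp (- u) * (t + u) powr (- (c + 1)))) has_halfline_integral
     (stieltjes_gamma (b + 1) (c + 1) t + t * stieltjes_gamma b (c + 1) t)"
    using has_bochner_integral_add[OF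
       stieltjes_gamma_integral[of "b + 1" "c + 1" t, unfolded has_halfline_integral_def]
       halfline_integral_cmult[OF stieltjes_gamma_integral[of b "c + 1" t], of t,
         unfolded has_halfline_integral_def]] b c t
    by (simp add: has_halfline_integral_def distrib_left)
  moreover have "u powr (b + 1 - 1) * exp (- u) * (t + u) powr (- (c + 1)) +
        t * (u powr (b - 1) * exp (- u) * (t + u) powr (- (c + 1))) =
      u powr (b - 1) * exp (- u) * (t + u) powr (- c)" if u: "u > 0" for u
  proof -
    have "u powr (b + 1 - 1) = u * u powr (b - 1)" using u by (simp add: powr_diff)
    moreover have "(t + u) powr (- c) = (t + u) * (t + u) powr (- (c + 1))"
      using u t powr_add[of "t + u" 1 "- (c + 1)"] by simp
    ultimately show ?thesis by (simp only: ring_distribs) simp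
  qed
  ultimately have "(\<lambda>u. u powr (b - 1) * exp (- u) * (t + u) powr (- c)) has_halfline_integral
     (stieltjes_gamma (b + 1) (c + 1) t + t * stieltjes_gamma b (c + 1) t)"
    by (subst (asm) halfline_integral_cong) auto
  from halfline_integral_unique[OF this stieltjes_gamma_integral[OF assms]]
  show ?thesis by simp
qed

text \<open>After the lower limit is moved to 0, \<open>(t + v) powr (- \<nu> - 1)\<close> is
  written as a Gamma integral in \<open>z\<close>. Integrating \<open>v\<close> out leaves
  \<open>1 / (1 + z)\<close>, and the substitution \<open>u = t * z\<close> produces the Stieltjes
  form.\<close>

lemma powr_exp_inc_Gamma:
  assumes \<nu>: "\<nu> > - 1" and t: "t > 0"
  shows "t powr \<nu> * exp t * inc_Gamma (- \<nu>) t = stieltjes_gamma (\<nu> + 1) 1 t / Gamma (\<nu> + 1)"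
proof -
  have G: "Gamma (\<nu> + 1) > 0" using \<nu> by simp
  have shift: "inc_Gamma (- \<nu>) t = exp (- t) * (LBINT v:{0<..}. exp (- v) * (t + v) powr (- \<nu> - 1))"
  proof -
    have "inc_Gamma (- \<nu>) t =
        (\<integral>v. indicator {t<..} (t + v) *\<^sub>R (exp (- (t + v)) * (t + v) powr (- \<nu> - 1)) \<partial>lborel)"
      unfolding inc_Gamma_def set_lebesgue_integral_def
      by (subst lborel_integral_real_affine[where t = t and c = 1]) auto
    also have "\<dots> = (LBINT v:{0<..}. exp (- t) * (exp (- v) * (t + v) powr (- \<nu> - 1)))"
      unfolding set_lebesgue_integral_def
      by (intro Bochner_Integration.integral_cong) (auto simp: indicator_def exp_diff exp_minus field_simps)
    finally show ?thesis by simp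
  qed
  have "(\<lambda>v. exp (- v) * (Gamma (\<nu> + 1) * (t + v) powr (- (\<nu> + 1)))) has_halfline_integral
      t powr (- \<nu>) * stieltjes_gamma (\<nu> + 1) 1 t"
  proof (rule halfline_integral_swap[where
        F = "\<lambda>z v. exp (- v) * (z powr (\<nu> + 1 - 1) * exp (- ((t + v) * z)))"])
    fix z :: real assume z: "z > 0"
    show "(\<lambda>v. exp (- v) * (z powr (\<nu> + 1 - 1) * exp (- ((t + v) * z))))
       has_halfline_integral z powr \<nu> * exp (- (t * z)) * (1 + z) powr (- 1)"
      using halfline_integral_cmult[OF halfline_Gamma[OF less_numeral_extra(1), of "1 + z"],
          of "z powr \<nu> * exp (- (t * z))"]
      by (rule halfline_integral_transform)
         (use z in \<open>auto simp: algebra_simps exp_diff exp_minus exp_add field_simps\<close>)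
  next
    have "(\<lambda>z. (t * z) powr (\<nu> + 1 - 1) * exp (- (t * z)) * (t + t * z) powr (- 1)) has_halfline_integral
        stieltjes_gamma (\<nu> + 1) 1 t / t"
      using halfline_integral_scale[OF stieltjes_gamma_integral[of "\<nu> + 1" 1 t], of t] \<nu> t by simp
    \<comment> \<open>The factor \<open>t\<close> cancels the Jacobian of the scaling;
      \<open>t powr (- \<nu>)\<close> cancels the power of \<open>t\<close> coming out of
      \<open>(t * z) powr \<nu>\<close>.\<close>
    from halfline_integral_cmult[OF this, of "t * t powr (- \<nu>)"]
    show "(\<lambda>z. z powr \<nu> * exp (- (t * z)) * (1 + z) powr (- 1)) has_halfline_integral
       t powr (- \<nu>) * stieltjes_gamma (\<nu> + 1) 1 t"
    proof (rule halfline_integral_transform)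
      fix z :: real assume z: "z > 0"
      have "t + t * z = t * (1 + z)" by (simp add: algebra_simps)
      then have "(t + t * z) powr (- 1) = (1 + z) powr (- 1) / t"
        using z t by (simp only: powr_mult) (simp add: powr_minus divide_inverse)
      then have "t * t powr (- \<nu>) * ((t * z) powr (\<nu> + 1 - 1) * exp (- (t * z)) * (t + t * z) powr (- 1)) =
          (t powr (- \<nu>) * t powr \<nu>) * (z powr \<nu> * exp (- (t * z)) * (1 + z) powr (- 1))"
        using z t by (simp only: powr_mult) simp
      also have "t powr (- \<nu>) * t powr \<nu> = 1" using t by (simp add: powr_minus)
      finally show "t * t powr (- \<nu>) * ((t * z) powr (\<nu> + 1 - 1) * exp (- (t * z)) * (t + t * z) powr (- 1)) =
         z powr \<nu> * exp (- (t * z)) * (1 + z) powr (- 1)" by simp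
    qed (use t in auto)
  next
    fix v :: real assume v: "v > 0"
    show "(\<lambda>z. exp (- v) * (z powr (\<nu> + 1 - 1) * exp (- ((t + v) * z)))) has_halfline_integral
       exp (- v) * (Gamma (\<nu> + 1) * (t + v) powr (- (\<nu> + 1)))"
      using v t \<nu> by (intro halfline_integral_cmult halfline_Gamma) auto
  qed auto
  from halfline_integral_cmult[OF this, of "1 / Gamma (\<nu> + 1)"]
  have "(\<lambda>v. exp (- v) * (t + v) powr (- \<nu> - 1)) has_halfline_integral
      t powr (- \<nu>) * stieltjes_gamma (\<nu> + 1) 1 t / Gamma (\<nu> + 1)"
    by (rule halfline_integral_transform) (use G in auto)
  from halfline_integral_eq[OF this] show ?thesis
    unfolding shift using t by (simp add: exp_minus powr_minus field_simps)
qed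

text \<open>Differentiating \<open>s ^ Suc k\<close> times the Stieltjes integral gives
  \<open>Suc k\<close> times the left side of the contiguous relation, so one more
  \<open>theta\<close> replaces \<open>k\<close> by \<open>Suc k\<close> throughout.\<close>

lemma theta_funpow_inc_Gamma:
  assumes \<nu>: "\<nu> > - 1" and t: "t > 0"
  shows "(theta ^^ k) (\<lambda>s. s powr \<nu> * exp s * inc_Gamma (- \<nu>) s) t =
     fact k / Gamma (\<nu> + 1) * t ^ k * stieltjes_gamma (\<nu> + real k + 1) (real k + 1) t"
  using t
proof (induction k arbitrary: t)
  case 0
  then show ?case using powr_exp_inc_Gamma[OF \<nu>] by simp
next
  case (Suc k)
  let ?H = "\<lambda>c. stieltjes_gamma (\<nu> + real k + 1) c"
  let ?f = "(theta ^^ k) (\<lambda>s. s powr \<nu> * exp s * inc_Gamma (- \<nu>) s)"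
  have "((\<lambda>s. fact k / Gamma (\<nu> + 1) * (s ^ Suc k * ?H (real k + 1) s)) has_real_derivative
      fact k / Gamma (\<nu> + 1) * (real (Suc k) * t ^ k * ?H (real k + 1) t +
        t ^ Suc k * (- (real k + 1) * ?H (real k + 1 + 1) t))) (at t)"
  proof (rule DERIV_cmult)
    have "((\<lambda>s. s ^ Suc k) has_real_derivative real (Suc k) * t ^ k) (at t)"
      using DERIV_pow[of "Suc k" t] by simp
    moreover have "(?H (real k + 1) has_real_derivative - (real k + 1) * ?H (real k + 1 + 1) t) (at t)"
      using \<nu> Suc.prems by (intro stieltjes_gamma_deriv) auto
    ultimately show "((\<lambda>s. s ^ Suc k * ?H (real k + 1) s) has_real_derivative
      (real (Suc k) * t ^ k * ?H (real k + 1) t +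
        t ^ Suc k * (- (real k + 1) * ?H (real k + 1 + 1) t))) (at t)"
      using DERIV_mult by (fastforce simp: algebra_simps)
  qed
  \<comment> \<open>The derivative depends only on values near \<open>t\<close>, so the induction
    hypothesis at positive points is enough.\<close>
  moreover have "eventually (\<lambda>s. s * ?f s = fact k / Gamma (\<nu> + 1) * (s ^ Suc k * ?H (real k + 1) s)) (nhds t)"
    using eventually_nhds_in_open[of "{0<..}" t] Suc.prems
    by (auto elim!: eventually_mono simp: Suc.IH)
  ultimately have "((\<lambda>s. s * ?f s) has_real_derivative
      fact k / Gamma (\<nu> + 1) * (real (Suc k) * t ^ k * ?H (real k + 1) t +
        t ^ Suc k * (- (real k + 1) * ?H (real k + 1 + 1) t))) (at t)"
    by (subst DERIV_cong_ev[OF refl _ refl])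
  then have "(theta ^^ Suc k) (\<lambda>s. s powr \<nu> * exp s * inc_Gamma (- \<nu>) s) t =
      t * (fact k / Gamma (\<nu> + 1) * (real (Suc k) * t ^ k * ?H (real k + 1) t +
        t ^ Suc k * (- (real k + 1) * ?H (real k + 1 + 1) t)))"
    by (simp add: theta_def DERIV_imp_deriv)
  also have "\<dots> = fact (Suc k) / Gamma (\<nu> + 1) * t ^ Suc k * (?H (real k + 1) t - t * ?H (real k + 1 + 1) t)"
    by (simp add: algebra_simps add_divide_distrib)
  also have "?H (real k + 1) t - t * ?H (real k + 1 + 1) t =
      stieltjes_gamma (\<nu> + real (Suc k) + 1) (real (Suc k) + 1) t"
    using stieltjes_gamma_contiguous[of "\<nu> + real k + 1" "real k + 1" t] \<nu> Suc.prems
    by (simp add: ac_simps)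
  finally show ?case .
qed

definition theta_moment :: "real \<Rightarrow> nat \<Rightarrow> nat \<Rightarrow> real" where
  "theta_moment \<nu> k a = fact k * Gamma (2 * \<nu> + real k + real a + 1) * Gamma (\<nu> + real k + real a + 1) *
     Gamma (\<nu> + real k + 1) / (Gamma (\<nu> + 1) * Gamma (2 * \<nu> + 2 * real k + real a + 2))"

lemma theta_moment_integral:
  assumes \<nu>: "\<nu> > - 1 / 2"
  shows "(\<lambda>t. t powr \<nu> * exp (- t) * t ^ a *
            (theta ^^ k) (\<lambda>s. s powr \<nu> * exp s * inc_Gamma (- \<nu>) s) t)
          has_halfline_integral theta_moment \<nu> k a"
proof -
  have "(\<lambda>t. fact k / Gamma (\<nu> + 1) * (t powr (\<nu> + real k + real a + 1 - 1) * exp (- t) *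
          stieltjes_gamma (\<nu> + real k + 1) (real k + 1) t)) has_halfline_integral
        fact k / Gamma (\<nu> + 1) * (Gamma (\<nu> + real k + real a + 1) * Gamma (\<nu> + real k + 1) *
          Gamma (\<nu> + real k + real a + 1 + (\<nu> + real k + 1) - (real k + 1)) /
          Gamma (\<nu> + real k + real a + 1 + (\<nu> + real k + 1)))"
    using \<nu> by (intro halfline_integral_cmult stieltjes_gamma_Gamma_integral) auto
  then show ?thesis
  proof (rule halfline_integral_transform)
    fix t :: real assume t: "t > 0"
    have "t powr (\<nu> + real k + real a + 1 - 1) = t powr \<nu> * t ^ k * t ^ a"
      using t by (simp add: powr_add powr_realpow)
    then show "fact k / Gamma (\<nu> + 1) * (t powr (\<nu> + real k + real a + 1 - 1) * exp (- t) *
        stieltjes_gamma (\<nu> + real k + 1) (real k + 1) t) = t powr \<nu> * exp (- t) * t ^ a *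
          (theta ^^ k) (\<lambda>s. s powr \<nu> * exp s * inc_Gamma (- \<nu>) s) t"
      using \<nu> t by (subst theta_funpow_inc_Gamma) (auto simp: mult_ac)
  qed (auto simp: theta_moment_def algebra_simps)
qed

section \<open>The weight function rho\<close>

text \<open>A single term of the series of \<open>exp (x / t)\<close> bounds it from below. Thus the
  factor beats every power of \<open>t\<close> at 0, which makes the integral for \<open>rho\<close>
  converge for all real \<open>\<nu>\<close>.\<close>

lemma exp_minus_divide_le:
  assumes "t > 0" and "x > (0::real)"
  shows "exp (- (x / t)) \<le> fact N / x ^ N * t ^ N"
proof -
  have "(x / t) ^ N / fact N \<le> exp (x / t)"
  proof -
    have "(x / t) ^ N /\<^sub>R fact N \<le> (\<Sum>n. (x / t) ^ n /\<^sub>R fact n)"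
      using assms by (intro sum_le_suminf[of _ "{N}", simplified] summable_exp_generic) auto
    then show ?thesis by (simp add: exp_def divide_inverse mult.commute)
  qed
  then show ?thesis using assms by (simp add: exp_minus field_simps)
qed

text \<open>The substitution \<open>t = c * exp u\<close>. The change of variables theorem speaks of
  Lebesgue measurable functions, so Borel measurability is established separately.\<close>

lemma halfline_exp_substitution:
  assumes f: "f has_halfline_integral v" and c: "c > 0"
  shows "has_bochner_integral lborel (\<lambda>u. c * exp u * f (c * exp u)) v"
proof -
  have img: "(\<lambda>u. c * exp u) ` UNIV = {0<..}"
  proof (intro equalityI subsetI)
    fix y :: real assume "y \<in> {0<..}"
    then have "y = c * exp (ln (y / c))" using c by simp
    then show "y \<in> (\<lambda>u. c * exp u) ` UNIV" by blast
  qed (use c in auto)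
  have der: "((\<lambda>u. c * exp u) has_real_derivative c * exp u) (at u)" for u
    by (auto intro!: derivative_eq_intros)
  have set_int: "set_integrable lborel {0<..} f" and "integral {0<..} f = v"
    using f set_borel_integral_eq_integral(2)[of "{0<..}" f]
    by (auto simp: has_halfline_integral_iff)
  moreover have "f absolutely_integrable_on {0<..}"
    using set_int unfolding set_integrable_def
    by (subst integrable_completion) (auto dest: borel_measurable_integrable)
  ultimately have *: "(\<lambda>u. \<bar>c * exp u\<bar> * f (c * exp u)) absolutely_integrable_on UNIV"
      "integral UNIV (\<lambda>u. \<bar>c * exp u\<bar> * f (c * exp u)) = v"
    using has_absolute_integral_change_of_variables_1'[of UNIV "\<lambda>u. c * exp u" "\<lambda>u. c * exp u" f v] c
    using der by (auto simp: img inj_on_def)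
  have "(\<lambda>t. indicator {0<..} t *\<^sub>R f t) \<in> borel_measurable lborel"
    using set_int unfolding set_integrable_def by (rule borel_measurable_integrable)
  then have "(\<lambda>u. c * exp u * (indicator {0<..} (c * exp u) *\<^sub>R f (c * exp u))) \<in> borel_measurable lborel"
    by measurable
  then have meas: "(\<lambda>u. c * exp u * f (c * exp u)) \<in> borel_measurable lborel"
    using c by simp
  have int: "integrable lborel (\<lambda>u. c * exp u * f (c * exp u))"
    using *(1) c meas by (simp add: set_integrable_def integrable_completion)
  moreover have "integral\<^sup>L lborel (\<lambda>u. c * exp u * f (c * exp u)) = v"
    using *(2) c integral_lborel[OF int] by simp
  ultimately show ?thesis by (simp add: has_bochner_integral_iff)
qed

lemma borel_measurable_cosh_real [measurable]: "cosh \<in> borel_measurable (borel :: real measure)"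
  by (intro borel_measurable_continuous_onI continuous_intros)

text \<open>Substituting \<open>t = sqrt x * exp u\<close> turns \<open>- t - x / t\<close> into
  \<open>- 2 * sqrt x * cosh u\<close>. Averaging over \<open>u\<close> and \<open>- u\<close>
  replaces \<open>exp (\<nu> * u)\<close> by \<open>cosh (\<nu> * u)\<close>, and evenness halves
  the line.\<close>

lemma rho_integral:
  assumes x: "x > 0"
  shows "(\<lambda>t. t powr (\<nu> - 1) * exp (- t - x / t)) has_halfline_integral rho \<nu> x"
proof -
  define f where "f t = t powr (\<nu> - 1) * exp (- t - x / t)" for t
  \<comment> \<open>This choice makes \<open>\<nu> + N\<close> positive, so that the dominating
    function is a convergent Gamma integrand.\<close>
  obtain N :: nat where N: "real N > - \<nu>" using reals_Archimedean2 by blast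
  have "set_integrable lborel {0<..} f"
  proof (rule set_integrable_bound)
    show "set_integrable lborel {0<..}
        (\<lambda>t. fact N / x ^ N * (t powr (\<nu> + real N - 1) * exp (- (1 * t))))"
      using halfline_integral_cmult[OF halfline_Gamma[of "\<nu> + real N" 1]] N
      by (auto simp: has_halfline_integral_iff)
    show "AE t in lborel. t \<in> {0<..} \<longrightarrow> norm (f t) \<le>
        norm (fact N / x ^ N * (t powr (\<nu> + real N - 1) * exp (- (1 * t))))"
    proof (intro AE_I2 impI)
      fix t :: real assume "t \<in> {0<..}"
      then have t: "t > 0" by simp
      have "f t = t powr (\<nu> - 1) * exp (- t) * exp (- (x / t))"
        by (simp add: f_def exp_diff exp_minus divide_inverse)
      also have "\<dots> \<le> t powr (\<nu> - 1) * exp (- t) * (fact N / x ^ N * t ^ N)"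
        using exp_minus_divide_le[OF t x] by (intro mult_left_mono) auto
      also have "\<dots> = fact N / x ^ N * (t powr (\<nu> + real N - 1) * exp (- (1 * t)))"
        using t powr_add[of t "\<nu> - 1" "real N"] powr_realpow[of t N] by (simp add: algebra_simps)
      finally show "norm (f t) \<le> norm (fact N / x ^ N * (t powr (\<nu> + real N - 1) * exp (- (1 * t))))"
        using x by (simp add: f_def)
    qed
  qed (simp add: set_borel_measurable_def f_def)
  then obtain v where v: "f has_halfline_integral v" by (simp add: has_halfline_integral_iff)
  define h where "h u = exp (- (2 * sqrt x) * cosh u) * exp (\<nu> * u)" for u
  have eq: "sqrt x * exp u * f (sqrt x * exp u) = x powr (\<nu> / 2) * h u" for u
  proof -
    have "x / (sqrt x * exp u) = sqrt x * exp (- u)"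
      using x by (simp add: exp_minus field_simps)
    then have "exp (- (sqrt x * exp u) - x / (sqrt x * exp u)) = exp (- (2 * sqrt x) * cosh u)"
      by (simp add: cosh_def algebra_simps)
    moreover have "sqrt x * exp u * (sqrt x * exp u) powr (\<nu> - 1) = (sqrt x * exp u) powr \<nu>"
      using x by (simp add: powr_diff)
    moreover have "(sqrt x * exp u) powr \<nu> = x powr (\<nu> / 2) * exp (\<nu> * u)"
      using x by (simp add: powr_mult powr_half_sqrt[symmetric] powr_powr exp_powr_real mult.commute)
    ultimately show ?thesis by (simp add: f_def h_def)
  qed
  from halfline_exp_substitution[OF v, of "sqrt x"] x
  have "has_bochner_integral lborel (\<lambda>u. x powr (\<nu> / 2) * h u) v" by (simp add: eq)
  from has_bochner_integral_mult_right[OF this, of "x powr (- \<nu> / 2)"]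
  have h: "has_bochner_integral lborel h (x powr (- \<nu> / 2) * v)"
    using x by (simp add: mult.assoc[symmetric] powr_add[symmetric])
  have h': "has_bochner_integral lborel (\<lambda>u. h (- u)) (x powr (- \<nu> / 2) * v)"
    using lborel_has_bochner_integral_real_affine_iff[of "- 1" h "x powr (- \<nu> / 2) * v" 0] h by simp
  define E where "E u = exp (- (2 * sqrt x) * cosh u) * cosh (\<nu> * u)" for u
  have E_eq: "E u = (h u + h (- u)) / 2" for u
    by (simp add: E_def h_def cosh_def[of "\<nu> * u"] algebra_simps add_divide_distrib)
  have E: "has_bochner_integral lborel E (x powr (- \<nu> / 2) * v)"
    using has_bochner_integral_mult_right[OF has_bochner_integral_add[OF h h'], of "1 / 2"]
    unfolding E_eq[abs_def] by (simp add: mult.commute)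
  have int: "integrable lborel (\<lambda>u. indicator {0<..} u *\<^sub>R E u)"
    using E by (intro integrable_mult_indicator) (auto simp: has_bochner_integral_iff)
  have "(\<integral>u. E u \<partial>lborel) = (\<integral>u. indicator {0<..} u *\<^sub>R E u + indicator {0<..} (- u) *\<^sub>R E (- u) \<partial>lborel)"
  proof (rule integral_cong_AE)
    show "AE u in lborel. E u = indicator {0<..} u *\<^sub>R E u + indicator {0<..} (- u) *\<^sub>R E (- u)"
      using AE_lborel_singleton[of "0::real"]
      by eventually_elim (auto simp: indicator_def E_def)
  qed (auto simp: E_def)
  also have "\<dots> = 2 * (LBINT u:{0<..}. E u)"
    using int lborel_integrable_real_affine[OF int, of "- 1" 0]
      lborel_integral_real_affine[of "- 1" "\<lambda>u. indicator {0<..} u *\<^sub>R E u" 0]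
    by (simp add: set_lebesgue_integral_def)
  finally have "x powr (- \<nu> / 2) * v = 2 * macdonald_K \<nu> (2 * sqrt x)"
    using E by (simp add: has_bochner_integral_iff macdonald_K_def E_def[abs_def])
  then have "rho \<nu> x = x powr (\<nu> / 2) * (x powr (- \<nu> / 2) * v)"
    by (simp add: rho_def)
  also have "\<dots> = v" using x by (simp add: mult.assoc[symmetric] powr_add[symmetric])
  finally show ?thesis using v by (simp add: f_def[abs_def])
qed

text \<open>The Macdonald function is even in its index, because \<open>cosh\<close> is
  even.\<close>

lemma rho_minus: "x > 0 \<Longrightarrow> rho (- \<nu>) x = x powr (- \<nu>) * rho \<nu> x"
  by (simp add: rho_def macdonald_K_def powr_add[symmetric])

text \<open>Differentiating \<open>exp (- x / t)\<close> brings down \<open>- 1 / t\<close>, which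
  lowers the index by one; the integrand at \<open>x / 2\<close> dominates.\<close>

lemma rho_deriv:
  assumes x: "x > 0"
  shows "(rho \<nu> has_real_derivative - rho (\<nu> - 1) x) (at x)"
proof (rule has_derivative_halfline_integral[where a = "x / 2" and b = "2 * x" and
      F = "\<lambda>x t. t powr (\<nu> - 1) * exp (- t - x / t)" and
      F' = "\<lambda>x t. - (1) * (t powr (\<nu> - 1 - 1) * exp (- t - x / t))" and
      g = "\<lambda>t. t powr (\<nu> - 1 - 1) * exp (- t - (x / 2) / t)"])
  show "(\<lambda>t. - (1) * (t powr (\<nu> - 1 - 1) * exp (- t - x / t))) has_halfline_integral - rho (\<nu> - 1) x"
    using halfline_integral_cmult[OF rho_integral[OF x, of "\<nu> - 1"], of "- 1"] by simp
  show "(\<lambda>t. t powr (\<nu> - 1 - 1) * exp (- t - (x / 2) / t)) has_halfline_integral rho (\<nu> - 1) (x / 2)"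
    using x by (intro rho_integral) auto
next
  fix s t :: real assume s: "x / 2 < s" and t: "t > 0"
  show "((\<lambda>x. t powr (\<nu> - 1) * exp (- t - x / t)) has_real_derivative
      - (1) * (t powr (\<nu> - 1 - 1) * exp (- t - s / t))) (at s)"
    using t powr_diff[of t "\<nu> - 1" 1] by (auto intro!: derivative_eq_intros)
  have "exp (- t - s / t) \<le> exp (- t - (x / 2) / t)"
    using s t by (simp add: divide_right_mono field_simps)
  then show "\<bar>- (1) * (t powr (\<nu> - 1 - 1) * exp (- t - s / t))\<bar>
      \<le> t powr (\<nu> - 1 - 1) * exp (- t - (x / 2) / t)"
    by (simp add: abs_mult mult_left_mono)
qed (use x in \<open>auto intro!: rho_integral\<close>)

lemma rho_pos:
  assumes "x > 0" shows "rho \<nu> x > 0"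
  by (rule halfline_integral_pos[OF rho_integral[OF assms]]) auto

text \<open>The derivative of \<open>rho \<nu>\<close> is computed twice, directly and through
  \<open>rho \<nu> y = y powr \<nu> * rho (- \<nu>) y\<close>. The resulting three-term recurrence
  stands in for the Bessel equation.\<close>

lemma rho_contiguous:
  assumes x: "x > 0"
  shows "x * rho (\<nu> - 1) x = rho (\<nu> + 1) x - \<nu> * rho \<nu> x"
proof -
  have "((\<lambda>y. y powr \<nu> * rho (- \<nu>) y) has_real_derivative
      \<nu> * x powr (\<nu> - 1) * rho (- \<nu>) x + x powr \<nu> * (- rho (- \<nu> - 1) x)) (at x)"
    using x by (auto intro!: derivative_eq_intros rho_deriv)
  moreover have "y powr \<nu> * rho (- \<nu>) y = rho \<nu> y" if "y \<in> {0<..}" for y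
    using that by (simp add: rho_minus powr_minus)
  ultimately have "(rho \<nu> has_real_derivative
      \<nu> * x powr (\<nu> - 1) * rho (- \<nu>) x + x powr \<nu> * (- rho (- \<nu> - 1) x)) (at x)"
    using x by (elim has_field_derivative_transform_within_open[where S = "{0<..}"]) auto
  then have "- rho (\<nu> - 1) x = \<nu> * x powr (\<nu> - 1) * rho (- \<nu>) x + x powr \<nu> * (- rho (- \<nu> - 1) x)"
    using rho_deriv[OF x] DERIV_unique by blast
  moreover have "rho (- \<nu> - 1) x = x powr (- \<nu> - 1) * rho (\<nu> + 1) x"
    using rho_minus[OF x, of "\<nu> + 1"] by simp
  ultimately have "- rho (\<nu> - 1) x = \<nu> * (x powr (\<nu> - 1) * x powr - \<nu>) * rho \<nu> x -
      x powr \<nu> * x powr (- \<nu> - 1) * rho (\<nu> + 1) x"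
    using rho_minus[OF x, of \<nu>] by simp
  also have "x powr (\<nu> - 1) * x powr - \<nu> = 1 / x"
    using x powr_add[of x "\<nu> - 1" "- \<nu>"] by (simp add: powr_neg_one)
  also have "x powr \<nu> * x powr (- \<nu> - 1) = 1 / x"
    using x powr_add[of x \<nu> "- \<nu> - 1"] by (simp add: powr_neg_one)
  finally show ?thesis using x by (simp add: field_simps)
qed

section \<open>Moments of the squared weight\<close>

definition rho_moment :: "real \<Rightarrow> nat \<Rightarrow> real" where
  "rho_moment \<nu> j = fact j * Gamma (2 * \<nu> + real j + 1) * Gamma (\<nu> + real j + 1) ^ 2 /
     Gamma (2 * \<nu> + 2 * real j + 2)"

lemma powr_minus_Suc:
  assumes "(s :: real) > 0" shows "s powr (- (real j + 1)) = 1 / s ^ Suc j"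
  using assms powr_realpow[of s "Suc j"] powr_minus_divide[of s "real (Suc j)"] by (simp add: add_ac)

lemma halfline_power:
  assumes s: "s > 0"
  shows "(\<lambda>x. x ^ j * exp (- (s * x))) has_halfline_integral fact j / s ^ Suc j"
  by (rule halfline_integral_transform[OF halfline_Gamma[of "real j + 1" s]])
     (use s powr_minus_Suc[OF s] in \<open>auto simp: powr_realpow Gamma_fact[symmetric] add_ac\<close>)

text \<open>With both factors \<open>rho\<close> written as integrals over \<open>t\<close> and
  \<open>u\<close>, the integral in \<open>x\<close> gives \<open>j!\<close> times a power of
  \<open>t * u / (t + u)\<close>. The integral in \<open>u\<close> is then a
  \<open>stieltjes_gamma\<close>, and its Gamma integral in \<open>t\<close> is already
  known.\<close>

lemma rho_moment_integral:
  assumes \<nu>: "\<nu> > - 1 / 2"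
  shows "(\<lambda>x. x ^ j * (rho \<nu> x)\<^sup>2) has_halfline_integral rho_moment \<nu> j"
proof -
  let ?r = "\<lambda>x t. t powr (\<nu> - 1) * exp (- t - x / t)"
  have inner: "(\<lambda>x. x ^ j * ?r x t * rho \<nu> x) has_halfline_integral
      fact j * (t powr (\<nu> + real j + 1 - 1) * exp (- t) * stieltjes_gamma (\<nu> + real j + 1) (real j + 1) t)"
    if t: "t > 0" for t
  proof (rule halfline_integral_swap[where F = "\<lambda>u x. x ^ j * ?r x t * ?r x u"])
    fix u :: real assume u: "u > 0"
    have "1 / t + 1 / u > 0" using t u by (simp add: add_pos_pos)
    from halfline_integral_cmult[OF halfline_power[OF this, of j],
        of "t powr (\<nu> - 1) * u powr (\<nu> - 1) * exp (- t) * exp (- u)"]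
    show "(\<lambda>x. x ^ j * ?r x t * ?r x u) has_halfline_integral
      fact j * t powr (\<nu> + real j) * exp (- t) *
        (u powr (\<nu> + real j + 1 - 1) * exp (- u) * (t + u) powr (- (real j + 1)))"
    proof (rule halfline_integral_transform)
      fix x :: real
      have "exp (- ((1 / t + 1 / u) * x)) = exp (- (x / t)) * exp (- (x / u))"
        by (simp add: exp_add[symmetric] algebra_simps)
      then show "t powr (\<nu> - 1) * u powr (\<nu> - 1) * exp (- t) * exp (- u) *
          (x ^ j * exp (- ((1 / t + 1 / u) * x))) = x ^ j * ?r x t * ?r x u"
        by (simp add: exp_diff exp_minus divide_inverse mult_ac)
    next
      have p: "v powr (\<nu> + real j) = v powr (\<nu> - 1) * v ^ Suc j" if "v > 0" for v
        using that powr_add[of v "\<nu> - 1" "real (Suc j)"] powr_realpow[of v "Suc j"] by (simp add: add_ac)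
      have "1 / t + 1 / u = (t + u) / (t * u)" using t u by (simp add: field_simps)
      then have "fact j / (1 / t + 1 / u) ^ Suc j = fact j * t ^ Suc j * u ^ Suc j * (1 / (t + u) ^ Suc j)"
        by (simp only: power_divide power_mult_distrib) simp
      moreover have "(t + u) powr (- (real j + 1)) = 1 / (t + u) ^ Suc j"
        using t u by (intro powr_minus_Suc) auto
      ultimately show "t powr (\<nu> - 1) * u powr (\<nu> - 1) * exp (- t) * exp (- u) *
          (fact j / (1 / t + 1 / u) ^ Suc j) =
          fact j * t powr (\<nu> + real j) * exp (- t) *
        (u powr (\<nu> + real j + 1 - 1) * exp (- u) * (t + u) powr (- (real j + 1)))"
        using p[OF t] p[OF u] by (simp only: add_diff_cancel_right') simp
    qed
  next
    show "(\<lambda>u. fact j * t powr (\<nu> + real j) * exp (- t) *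
        (u powr (\<nu> + real j + 1 - 1) * exp (- u) * (t + u) powr (- (real j + 1)))) has_halfline_integral
      fact j * (t powr (\<nu> + real j + 1 - 1) * exp (- t) * stieltjes_gamma (\<nu> + real j + 1) (real j + 1) t)"
      using halfline_integral_cmult[OF stieltjes_gamma_integral[of "\<nu> + real j + 1" "real j + 1" t],
          of "fact j * t powr (\<nu> + real j) * exp (- t)"] \<nu> t by (simp add: mult.assoc)
  next
    fix x :: real assume x: "x > 0"
    show "(\<lambda>u. x ^ j * ?r x t * ?r x u) has_halfline_integral x ^ j * ?r x t * rho \<nu> x"
      by (intro halfline_integral_cmult rho_integral x)
  qed auto
  have "(\<lambda>x. x ^ j * rho \<nu> x * rho \<nu> x) has_halfline_integral
      fact j * (Gamma (\<nu> + real j + 1) * Gamma (\<nu> + real j + 1) *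
        Gamma (\<nu> + real j + 1 + (\<nu> + real j + 1) - (real j + 1)) /
        Gamma (\<nu> + real j + 1 + (\<nu> + real j + 1)))"
  proof (rule halfline_integral_swap[where F = "\<lambda>t x. x ^ j * ?r x t * rho \<nu> x"])
    have [measurable]: "rho \<nu> \<in> borel_measurable borel"
      unfolding rho_def[abs_def] macdonald_K_def[abs_def] set_lebesgue_integral_def by measurable
    show "(\<lambda>(t, x). x ^ j * ?r x t * rho \<nu> x) \<in> borel_measurable (borel \<Otimes>\<^sub>M borel)"
      by measurable
    show "(\<lambda>t. fact j * (t powr (\<nu> + real j + 1 - 1) * exp (- t) *
        stieltjes_gamma (\<nu> + real j + 1) (real j + 1) t)) has_halfline_integral
      fact j * (Gamma (\<nu> + real j + 1) * Gamma (\<nu> + real j + 1) *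
        Gamma (\<nu> + real j + 1 + (\<nu> + real j + 1) - (real j + 1)) /
        Gamma (\<nu> + real j + 1 + (\<nu> + real j + 1)))"
      using \<nu> by (intro halfline_integral_cmult stieltjes_gamma_Gamma_integral) auto
    show "(\<lambda>t. x ^ j * ?r x t * rho \<nu> x) has_halfline_integral x ^ j * rho \<nu> x * rho \<nu> x"
      if x: "x > 0" for x
      using halfline_integral_cmult[OF rho_integral[OF x, of \<nu>], of "x ^ j * rho \<nu> x"]
      by (simp add: mult_ac)
    show "(\<lambda>x. x ^ j * ?r x t * rho \<nu> x) has_halfline_integral
      fact j * (t powr (\<nu> + real j + 1 - 1) * exp (- t) * stieltjes_gamma (\<nu> + real j + 1) (real j + 1) t)"
      if "t > 0" for t by (rule inner[OF that])
  qed (auto simp: less_imp_le rho_pos)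
  then show ?thesis
    by (rule halfline_integral_transform) (auto simp: rho_moment_def power2_eq_square algebra_simps)
qed

section \<open>Newton differences, moment functionals and Laguerre polynomials\<close>

definition newton_diff :: "(nat \<Rightarrow> real) \<Rightarrow> nat \<Rightarrow> real" where
  "newton_diff g k = (\<Sum>j\<le>k. (- 1) ^ j * real (k choose j) * g j)"

text \<open>\<open>newton_diff g k\<close> is \<open>(- 1) ^ k\<close> times the \<open>k\<close>-th
  forward difference of \<open>g\<close> at 0. This is its product rule, from
  \<open>(k - j) * (k choose j) = k * (k - 1 choose j)\<close>; at \<open>k = 0\<close> the
  truncated \<open>k - 1\<close> is multiplied by 0.\<close>

lemma newton_diff_mult_affine:
  "newton_diff (\<lambda>j. (c + real j) * g j) k =
     (c + real k) * newton_diff g k - real k * newton_diff g (k - 1)"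
proof (cases k)
  case (Suc n)
  have eq: "(c + real j) * real (Suc n choose j) =
      (c + real (Suc n)) * real (Suc n choose j) - real (Suc n) * real (n choose j)" if "j \<le> Suc n" for j
  proof -
    have "(Suc n - j) * (Suc n choose j) = Suc n * (n choose j)"
      using binomial_absorb_comp[of "Suc n" j] by simp
    then have "(real (Suc n) - real j) * real (Suc n choose j) = real (Suc n) * real (n choose j)"
      using that by (metis of_nat_diff of_nat_mult)
    then show ?thesis by (simp add: algebra_simps)
  qed
  have "newton_diff (\<lambda>j. (c + real j) * g j) k =
      (\<Sum>j\<le>Suc n. (- 1) ^ j * ((c + real j) * real (Suc n choose j)) * g j)"
    by (simp add: newton_diff_def Suc mult_ac)
  also have "\<dots> = (\<Sum>j\<le>Suc n. (- 1) ^ j * ((c + real (Suc n)) * real (Suc n choose j) -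
      real (Suc n) * real (n choose j)) * g j)"
    by (intro sum.cong refl) (simp only: eq atMost_iff)
  also have "\<dots> = (c + real k) * newton_diff g k - real (Suc n) * (\<Sum>j\<le>Suc n. (- 1) ^ j * real (n choose j) * g j)"
    unfolding newton_diff_def Suc sum_distrib_left sum_subtractf[symmetric]
    by (intro sum.cong refl) (simp add: algebra_simps)
  also have "(\<Sum>j\<le>Suc n. (- 1) ^ j * real (n choose j) * g j) = newton_diff g (k - 1)"
    by (simp add: newton_diff_def Suc)
  finally show ?thesis by (simp add: Suc)
qed (simp add: newton_diff_def)

lemma newton_diff_const: "newton_diff (\<lambda>_. 1) k = (if k = 0 then 1 else 0)"
  using choose_alternating_sum[of k, where ?'a = real] by (auto simp: newton_diff_def)

text \<open>As a function of \<open>j\<close> the Pochhammer symbol is a monic polynomial of degree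
  \<open>a\<close>: its \<open>a\<close>-th difference is \<open>a!\<close> and higher differences
  vanish.\<close>

lemma newton_diff_pochhammer:
  "a \<le> k \<Longrightarrow> newton_diff (\<lambda>j. pochhammer (x + real j) a) k = (if k = a then (- 1) ^ a * fact a else 0)"
proof (induction a arbitrary: k)
  case 0
  show ?case by (simp add: newton_diff_const)
next
  case (Suc a)
  have "newton_diff (\<lambda>j. pochhammer (x + real j) (Suc a)) k =
      newton_diff (\<lambda>j. (x + real a + real j) * pochhammer (x + real j) a) k"
    by (simp add: pochhammer_Suc algebra_simps)
  also have "\<dots> = (x + real a + real k) * newton_diff (\<lambda>j. pochhammer (x + real j) a) k -
      real k * newton_diff (\<lambda>j. pochhammer (x + real j) a) (k - 1)"
    by (rule newton_diff_mult_affine)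
  finally show ?case
    using Suc.IH[of k] Suc.IH[of "k - 1"] Suc.prems by auto
qed

section \<open>Linear functionals on polynomials given by their moments\<close>

definition moment_functional :: "(nat \<Rightarrow> real) \<Rightarrow> real poly \<Rightarrow> real" where
  "moment_functional J p = (\<Sum>i\<le>degree p. coeff p i * J i)"

lemma moment_functional_le:
  assumes "degree p \<le> n"
  shows "moment_functional J p = (\<Sum>i\<le>n. coeff p i * J i)"
  unfolding moment_functional_def using assms
  by (intro sum.mono_neutral_left) (auto simp: coeff_eq_0)

lemma moment_functional_add:
  "moment_functional J (p + q) = moment_functional J p + moment_functional J q"
proof -
  let ?n = "max (degree p) (degree q)"
  show ?thesis
    by (subst (1 2 3) moment_functional_le[of _ ?n])
       (auto simp: degree_add_le sum.distrib[symmetric] algebra_simps)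
qed

lemma moment_functional_smult:
  "moment_functional J (Polynomial.smult c p) = c * moment_functional J p"
  by (subst moment_functional_le[of _ "degree p"])
     (auto simp: degree_smult_le moment_functional_def sum_distrib_left mult.assoc)

lemma moment_functional_0 [simp]: "moment_functional J 0 = 0"
  by (simp add: moment_functional_def)

lemma moment_functional_sum:
  "moment_functional J (\<Sum>i\<in>I. p i) = (\<Sum>i\<in>I. moment_functional J (p i))"
  by (induction I rule: infinite_finite_induct) (auto simp: moment_functional_add)

lemma moment_functional_monom_mult:
  "moment_functional J (monom 1 a * p) = moment_functional (\<lambda>i. J (i + a)) p"
proof -
  have "moment_functional J (monom 1 a * p) = (\<Sum>i\<le>degree p + a. coeff (monom 1 a * p) i * J i)"
    using degree_mult_le[of "monom 1 a" p] by (intro moment_functional_le) (simp add: degree_monom_eq)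
  also have "\<dots> = (\<Sum>i\<in>{a..degree p + a}. coeff p (i - a) * J i)"
    by (rule sum.mono_neutral_cong_right) (auto simp: coeff_monom_mult)
  also have "\<dots> = (\<Sum>i\<in>{0..degree p}. coeff p i * J (i + a))"
    using sum.shift_bounds_cl_nat_ivl[of "\<lambda>i. coeff p (i - a) * J i" 0 a "degree p"] by simp
  finally show ?thesis by (simp add: moment_functional_def atMost_atLeast0)
qed

text \<open>Elimination of the leading term, one degree at a time. It serves both for the Laguerre
  polynomials and for the orthonormal family.\<close>

lemma poly_eq_sum_smult_basis:
  fixes P :: "nat \<Rightarrow> real poly"
  assumes P: "\<And>m. degree (P m) = m" "\<And>m. coeff (P m) m \<noteq> 0" and "degree p \<le> N"
  obtains c where "p = (\<Sum>m\<le>N. Polynomial.smult (c m) (P m))"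
proof -
  have "\<exists>c. p = (\<Sum>m\<le>N. Polynomial.smult (c m) (P m))"
    using assms(3)
  proof (induction N arbitrary: p)
    case 0
    have "p = Polynomial.smult (coeff p 0 / coeff (P 0) 0) (P 0)"
    proof -
      obtain a where a: "p = [:a:]" using 0 by (auto elim: degree_eq_zeroE)
      obtain b where b: "P 0 = [:b:]" using P(1)[of 0] by (auto elim: degree_eq_zeroE)
      show ?thesis using P(2)[of 0] by (simp add: a b)
    qed
    then show ?case by auto
  next
    case (Suc N)
    define b where "b = coeff p (Suc N) / coeff (P (Suc N)) (Suc N)"
    have "degree (p - Polynomial.smult b (P (Suc N))) \<le> N"
    proof (rule degree_le, intro allI impI)
      fix i assume "N < i"
      then consider "i = Suc N" | "Suc N < i" by linarith
      then show "coeff (p - Polynomial.smult b (P (Suc N))) i = 0"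
        using Suc.prems P by cases (auto simp: b_def coeff_eq_0)
    qed
    from Suc.IH[OF this] obtain c where c: "p - Polynomial.smult b (P (Suc N)) = (\<Sum>m\<le>N. Polynomial.smult (c m) (P m))"
      by blast
    have "p = (\<Sum>m\<le>Suc N. Polynomial.smult ((c(Suc N := b)) m) (P m))"
      using c by (simp add: algebra_simps)
    then show ?case by blast
  qed
  then show ?thesis using that by blast
qed

section \<open>Laguerre polynomials through their moment functional\<close>

definition laguerre_poly :: "real \<Rightarrow> nat \<Rightarrow> real poly" where
  "laguerre_poly \<nu> r = (\<Sum>i\<le>r. monom ((- 1) ^ i * ((real r + \<nu>) gchoose (r - i)) / fact i) i)"

lemma coeff_laguerre_poly:
  "coeff (laguerre_poly \<nu> r) i =
     (if i \<le> r then (- 1) ^ i * ((real r + \<nu>) gchoose (r - i)) / fact i else 0)"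
  by (simp add: laguerre_poly_def coeff_sum coeff_monom)

lemma degree_laguerre_poly: "degree (laguerre_poly \<nu> r) = r"
  by (intro antisym le_degree degree_le) (auto simp: coeff_laguerre_poly)

lemma poly_laguerre_poly: "poly (laguerre_poly \<nu> r) t = laguerre \<nu> r t"
  by (simp add: laguerre_poly_def laguerre_def poly_sum poly_monom)

text \<open>Coefficientwise form of the raising relation
  \<open>(m + 1) L_(m+1) = (\<nu> + 1 + m) L_m + t L_m' - t L_m\<close>, the differential step
  behind the Rodrigues formula.\<close>

lemma coeff_laguerre_poly_Suc:
  "real (Suc m) * coeff (laguerre_poly \<nu> (Suc m)) i =
     (\<nu> + 1 + real m + real i) * coeff (laguerre_poly \<nu> m) i - coeff (pCons 0 (laguerre_poly \<nu> m)) i"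
proof (cases i)
  case 0
  have "(real m + \<nu> + 1) * ((real m + \<nu>) gchoose m) = real (Suc m) * ((real m + \<nu> + 1) gchoose Suc m)"
    using gbinomial_absorption'[of "Suc m" "real m + \<nu> + 1"] by simp
  then show ?thesis by (simp add: 0 coeff_laguerre_poly add_ac)
next
  case (Suc j)
  consider "j < m" | "j = m" | "j > m" by linarith
  then show ?thesis
  proof cases
    case 1
    define N where "N = real m + \<nu>"
    obtain q where q: "m = j + Suc q" using 1 less_iff_Suc_add by auto
    have a: "real (Suc q) * ((N + 1) gchoose Suc q) = (N + 1) * (N gchoose q)"
      using gbinomial_absorption'[of "Suc q" "N + 1"] by simp
    have b: "(N + 1) gchoose Suc q = (N gchoose Suc q) + (N gchoose q)"
      using gbinomial_Suc_Suc[of N q] by simp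
    have N1: "real (Suc m) + \<nu> = N + 1" "real m + \<nu> = N" by (auto simp: N_def)
    \<comment> \<open>With \<open>Suc m = Suc q + Suc j\<close>, absorption treats the first part
      and Pascal's rule the second.\<close>
    have "real (Suc m) * ((N + 1) gchoose Suc q) =
        real (Suc q) * ((N + 1) gchoose Suc q) + real (Suc j) * ((N + 1) gchoose Suc q)"
      by (simp add: q algebra_simps)
    also have "\<dots> = (N + 1 + real (Suc j)) * (N gchoose q) + real (Suc j) * (N gchoose Suc q)"
      unfolding a by (simp only: b) (simp add: algebra_simps)
    finally have *: "real (Suc m) * ((N + 1) gchoose Suc q) =
        (\<nu> + 1 + real m + real (Suc j)) * (N gchoose q) + real (Suc j) * (N gchoose Suc q)"
      by (simp add: N_def algebra_simps)
    have ms: "Suc m - Suc j = Suc q" "m - Suc j = q" "m - j = Suc q" by (auto simp: q)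
    have "real (Suc m) * coeff (laguerre_poly \<nu> (Suc m)) i =
        (- 1) ^ Suc j / fact (Suc j) * (real (Suc m) * ((N + 1) gchoose Suc q))"
      using 1 by (simp only: coeff_laguerre_poly Suc ms N1) simp
    also have "\<dots> = (\<nu> + 1 + real m + real (Suc j)) * ((- 1) ^ Suc j * (N gchoose q) / fact (Suc j)) -
        (- 1) ^ j * (N gchoose Suc q) / fact j"
    proof -
      have "(- s) / (n * F) * (A * x + n * y) = A * ((- s) * x / (n * F)) - s * y / F"
        if "n \<noteq> 0" "F \<noteq> 0" for n F A x y s :: real
        using that by (simp add: field_simps)
      from this[of "real (Suc j)" "fact j" "(- 1) ^ j"] show ?thesis
        unfolding * by (simp del: of_nat_Suc)
    qed
    also have "\<dots> = (\<nu> + 1 + real m + real i) * coeff (laguerre_poly \<nu> m) i -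
        coeff (pCons 0 (laguerre_poly \<nu> m)) i"
      using 1 by (simp only: coeff_laguerre_poly Suc ms N1 coeff_pCons_Suc) simp
    finally show ?thesis .
  qed (auto simp: Suc coeff_laguerre_poly simp del: of_nat_Suc)
qed

lemma Gamma_add_of_nat:
  assumes "x > (0::real)"
  shows "Gamma (x + real n) = pochhammer x n * Gamma x"
proof -
  have "x \<notin> \<int>\<^sub>\<le>\<^sub>0" using assms by (auto elim!: nonpos_Ints_cases)
  from pochhammer_Gamma[OF this, of n] Gamma_real_pos[OF assms] show ?thesis
    by (simp add: field_simps)
qed

text \<open>Each Laguerre coefficient times its Gamma moment is a fixed constant times a signed
  binomial coefficient times a polynomial of degree \<open>a\<close> in the index. Orthogonality
  thus reduces to the vanishing of high differences.\<close>

lemma moment_functional_Gamma_laguerre: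
  assumes \<nu>: "\<nu> > - 1"
  shows "moment_functional (\<lambda>i. Gamma (\<nu> + real i + 1)) (monom 1 a * laguerre_poly \<nu> r) =
     Gamma (\<nu> + real r + 1) / fact r * newton_diff (\<lambda>i. pochhammer (\<nu> + 1 + real i) a) r"
proof -
  have "coeff (laguerre_poly \<nu> r) i * Gamma (\<nu> + real (i + a) + 1) =
      Gamma (\<nu> + real r + 1) / fact r * ((- 1) ^ i * real (r choose i) * pochhammer (\<nu> + 1 + real i) a)"
    if i: "i \<le> r" for i
  proof -
    have "(real r + \<nu>) gchoose (r - i) = pochhammer (\<nu> + 1 + real i) (r - i) / fact (r - i)"
      using i by (simp add: gbinomial_pochhammer' of_nat_diff add_ac)
    moreover have "Gamma (\<nu> + real r + 1) = pochhammer (\<nu> + 1 + real i) (r - i) * Gamma (\<nu> + 1 + real i)"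
      using Gamma_add_of_nat[of "\<nu> + 1 + real i" "r - i"] i \<nu> by (simp add: of_nat_diff add_ac)
    moreover have "Gamma (\<nu> + real (i + a) + 1) = pochhammer (\<nu> + 1 + real i) a * Gamma (\<nu> + 1 + real i)"
      using Gamma_add_of_nat[of "\<nu> + 1 + real i" a] \<nu> by (simp add: add_ac)
    ultimately show ?thesis using i
      by (simp add: coeff_laguerre_poly binomial_fact field_simps)
  qed
  then show ?thesis
    unfolding moment_functional_monom_mult
    by (simp add: moment_functional_def degree_laguerre_poly newton_diff_def sum_distrib_left)
qed

text \<open>By symmetry the smaller index may be expanded in monomials. Powers below
  \<open>r\<close> are annihilated, and for \<open>s = r\<close> the leading coefficient
  \<open>(- 1) ^ r / r!\<close> cancels the difference \<open>(- 1) ^ r * r!\<close>.\<close>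

lemma laguerre_orthogonal:
  assumes \<nu>: "\<nu> > - 1"
  shows "moment_functional (\<lambda>i. Gamma (\<nu> + real i + 1)) (laguerre_poly \<nu> s * laguerre_poly \<nu> r) =
     (if r = s then Gamma (\<nu> + real r + 1) / fact r else 0)"
proof -
  let ?M = "moment_functional (\<lambda>i. Gamma (\<nu> + real i + 1))"
  have less: "?M (laguerre_poly \<nu> s * laguerre_poly \<nu> r) =
      (if r = s then Gamma (\<nu> + real r + 1) / fact r else 0)" if "s \<le> r" for s r
  proof -
    have "laguerre_poly \<nu> s * laguerre_poly \<nu> r =
        (\<Sum>i\<le>s. Polynomial.smult (coeff (laguerre_poly \<nu> s) i) (monom 1 i * laguerre_poly \<nu> r))"
    proof -
      have "laguerre_poly \<nu> s = (\<Sum>i\<le>s. Polynomial.smult (coeff (laguerre_poly \<nu> s) i) (monom 1 i))"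
        using poly_as_sum_of_monoms[of "laguerre_poly \<nu> s"]
        by (simp add: degree_laguerre_poly smult_monom)
      from arg_cong[OF this, of "\<lambda>p. p * laguerre_poly \<nu> r"] show ?thesis
        by (simp add: sum_distrib_right)
    qed
    then have "?M (laguerre_poly \<nu> s * laguerre_poly \<nu> r) =
        (\<Sum>i\<le>s. coeff (laguerre_poly \<nu> s) i * (Gamma (\<nu> + real r + 1) / fact r *
           newton_diff (\<lambda>j. pochhammer (\<nu> + 1 + real j) i) r))"
      by (simp add: moment_functional_sum moment_functional_smult moment_functional_Gamma_laguerre[OF \<nu>])
    also have "\<dots> = (\<Sum>i\<in>{s}. if r = s then Gamma (\<nu> + real r + 1) / fact r else 0)"
      using that
      by (intro sum.mono_neutral_cong_right)
         (auto simp: newton_diff_pochhammer coeff_laguerre_poly)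
    finally show ?thesis by simp
  qed
  show ?thesis
    using less[of s r] less[of r s] by (cases "s \<le> r") (auto simp: mult.commute)
qed

text \<open>Expand \<open>p\<close> in Laguerre polynomials. By orthogonality the factors other than
  the value of \<open>J\<close> form the expansion coefficient, so the sum is \<open>J\<close>
  applied to the expansion. This collapses the sum defining \<open>coef_f\<close>.\<close>

lemma laguerre_expansion_functional:
  assumes \<nu>: "\<nu> > - 1" and p: "degree p \<le> N"
  shows "(\<Sum>r\<le>N. fact r / Gamma (1 + \<nu> + real r) * moment_functional J (laguerre_poly \<nu> r) *
            moment_functional (\<lambda>i. Gamma (\<nu> + real i + 1)) (p * laguerre_poly \<nu> r)) =
         moment_functional J p"
proof -
  let ?M = "moment_functional (\<lambda>i. Gamma (\<nu> + real i + 1))"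
  obtain c where c: "p = (\<Sum>m\<le>N. Polynomial.smult (c m) (laguerre_poly \<nu> m))"
    using poly_eq_sum_smult_basis[of "laguerre_poly \<nu>" p N] p
    by (auto simp: degree_laguerre_poly coeff_laguerre_poly)
  have cr: "fact r / Gamma (1 + \<nu> + real r) * ?M (p * laguerre_poly \<nu> r) = c r" if "r \<le> N" for r
  proof -
    have "?M (p * laguerre_poly \<nu> r) = (\<Sum>m\<le>N. c m * ?M (laguerre_poly \<nu> m * laguerre_poly \<nu> r))"
      by (simp add: c sum_distrib_right moment_functional_sum moment_functional_smult)
    also have "\<dots> = c r * (Gamma (\<nu> + real r + 1) / fact r)"
      using that by (simp add: laguerre_orthogonal[OF \<nu>] if_distrib sum.delta' cong: if_cong)
    finally have "?M (p * laguerre_poly \<nu> r) = c r * (Gamma (\<nu> + real r + 1) / fact r)" .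
    moreover have "Gamma (1 + \<nu> + real r) > 0" using \<nu> by simp
    ultimately show ?thesis by (simp add: add_ac)
  qed
  have "(\<Sum>r\<le>N. fact r / Gamma (1 + \<nu> + real r) * moment_functional J (laguerre_poly \<nu> r) *
      ?M (p * laguerre_poly \<nu> r)) = (\<Sum>r\<le>N. c r * moment_functional J (laguerre_poly \<nu> r))"
  proof (intro sum.cong refl)
    fix r assume "r \<in> {..N}"
    then have "c r = fact r / Gamma (1 + \<nu> + real r) * ?M (p * laguerre_poly \<nu> r)"
      by (simp only: cr atMost_iff)
    then show "fact r / Gamma (1 + \<nu> + real r) * moment_functional J (laguerre_poly \<nu> r) *
        ?M (p * laguerre_poly \<nu> r) = c r * moment_functional J (laguerre_poly \<nu> r)"
      by (simp only: mult_ac)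
  qed
  also have "\<dots> = moment_functional J p"
    by (subst c) (simp add: moment_functional_sum moment_functional_smult)
  finally show ?thesis .
qed

text \<open>The hypothesis on \<open>J\<close> is the integration by parts rule
  \<open>\<integral> \<theta> f \<cdot> g = - \<integral> f \<cdot> \<theta> g\<close> for \<open>f t = t powr (\<nu> + a) * exp (- t)\<close> and
  \<open>g = \<theta>\<^sup>k \<phi>\<close>, written for the moments; the conclusion corresponds to the Rodrigues formula
  \<open>\<theta>\<^sup>m (t\<^sup>\<nu> e\<^sup>-\<^sup>t) = m! t\<^sup>m\<^sup>+\<^sup>\<nu> e\<^sup>-\<^sup>t L\<^sub>m\<close>.\<close>
lemma moment_functional_rodrigues:
  assumes J: "\<And>k a. J (Suc k) a = J k (a + 2) - (\<nu> + 1 + real a) * J k (a + 1)"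
  shows "moment_functional (J k) (monom 1 m * laguerre_poly \<nu> m) = (- 1) ^ m / fact m * J (k + m) 0"
proof (induction m arbitrary: k)
  case 0
  then show ?case by (simp add: moment_functional_def laguerre_poly_def monom_0)
next
  case (Suc m)
  let ?l = "laguerre_poly \<nu> m"
  have "real (Suc m) * moment_functional (J k) (monom 1 (Suc m) * laguerre_poly \<nu> (Suc m)) =
      (\<Sum>i\<le>Suc m. real (Suc m) * coeff (laguerre_poly \<nu> (Suc m)) i * J k (i + Suc m))"
    unfolding moment_functional_monom_mult
    by (simp only: moment_functional_def degree_laguerre_poly sum_distrib_left mult.assoc)
  also have "\<dots> = (\<Sum>i\<le>Suc m. (\<nu> + 1 + real m + real i) * coeff ?l i * J k (i + Suc m)) -
      (\<Sum>i\<le>Suc m. coeff (pCons 0 ?l) i * J k (i + Suc m))"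
    unfolding coeff_laguerre_poly_Suc sum_subtractf[symmetric] by (simp only: left_diff_distrib)
  also have "(\<Sum>i\<le>Suc m. (\<nu> + 1 + real m + real i) * coeff ?l i * J k (i + Suc m)) =
      (\<Sum>i\<le>m. (\<nu> + 1 + real m + real i) * coeff ?l i * J k (i + Suc m))"
    by (simp add: coeff_laguerre_poly)
  also have "(\<Sum>i\<le>Suc m. coeff (pCons 0 ?l) i * J k (i + Suc m)) = (\<Sum>i\<le>m. coeff ?l i * J k (i + m + 2))"
    by (subst sum.atMost_Suc_shift) simp
  \<comment> \<open>The hypothesis on \<open>J\<close> with \<open>a = i + m\<close> merges the two
    sums; the minus sign accumulates to \<open>(- 1) ^ m\<close>.\<close>
  also have "(\<Sum>i\<le>m. (\<nu> + 1 + real m + real i) * coeff ?l i * J k (i + Suc m)) -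
      (\<Sum>i\<le>m. coeff ?l i * J k (i + m + 2)) = - (\<Sum>i\<le>m. coeff ?l i * J (Suc k) (i + m))"
    unfolding sum_subtractf[symmetric] sum_negf[symmetric]
    by (intro sum.cong refl) (simp add: J algebra_simps)
  also have "(\<Sum>i\<le>m. coeff ?l i * J (Suc k) (i + m)) = moment_functional (J (Suc k)) (monom 1 m * ?l)"
    unfolding moment_functional_monom_mult by (simp add: moment_functional_def degree_laguerre_poly)
  also have "- \<dots> = real (Suc m) * ((- 1) ^ Suc m / fact (Suc m) * J (k + Suc m) 0)"
    unfolding Suc.IH by (simp del: of_nat_Suc)
  finally have eq: "real (Suc m) * moment_functional (J k) (monom 1 (Suc m) * laguerre_poly \<nu> (Suc m)) =
      real (Suc m) * ((- 1) ^ Suc m / fact (Suc m) * J (k + Suc m) 0)" .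
  show ?case by (rule mult_left_cancel[THEN iffD1, OF _ eq]) simp
qed

section \<open>The Rodrigues-type expansion of a power times rho\<close>

text \<open>Candidate for the \<open>n\<close>-th derivative of \<open>x ^ k * rho \<nu> x\<close>:
  the base clause iterates the derivative of \<open>rho\<close>, and the other is Leibniz' rule for
  multiplication by \<open>x\<close>. At \<open>n = 0\<close> the truncated \<open>n - 1\<close> has
  factor 0.\<close>

primrec power_rho_deriv :: "real \<Rightarrow> nat \<Rightarrow> nat \<Rightarrow> real \<Rightarrow> real" where
  "power_rho_deriv \<nu> 0 n x = (- 1) ^ n * rho (\<nu> - real n) x"
| "power_rho_deriv \<nu> (Suc k) n x =
     x * power_rho_deriv \<nu> k n x + real n * power_rho_deriv \<nu> k (n - 1) x"

lemma power_rho_deriv_has_derivative: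
  assumes "x > 0"
  shows "(power_rho_deriv \<nu> k n has_real_derivative power_rho_deriv \<nu> k (Suc n) x) (at x)"
proof (induction k arbitrary: n)
  case 0
  have "((\<lambda>x. (- 1) ^ n * rho (\<nu> - real n) x) has_real_derivative (- 1) ^ n * - rho (\<nu> - real n - 1) x) (at x)"
    by (intro DERIV_cmult rho_deriv assms)
  then show ?case by (simp add: power_rho_deriv_def diff_diff_eq add.commute)
next
  case (Suc k)
  have "((\<lambda>x. x * power_rho_deriv \<nu> k n x + real n * power_rho_deriv \<nu> k (n - 1) x) has_real_derivative
      1 * power_rho_deriv \<nu> k n x + power_rho_deriv \<nu> k (Suc n) x * x +
        real n * power_rho_deriv \<nu> k (Suc (n - 1)) x) (at x)"
    by (intro DERIV_add DERIV_mult DERIV_cmult Suc.IH DERIV_ident)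
  then show ?case by (cases n) (simp_all add: algebra_simps)
qed

lemma deriv_funpow_power_rho:
  assumes "x > 0"
  shows "(deriv ^^ n) (\<lambda>y. y ^ k * rho \<nu> y) x = power_rho_deriv \<nu> k n x"
  using assms
proof (induction n arbitrary: x)
  case 0
  show ?case by (induction k) (simp_all add: mult_ac)
next
  case (Suc n)
  have "eventually (\<lambda>y. (deriv ^^ n) (\<lambda>y. y ^ k * rho \<nu> y) y = power_rho_deriv \<nu> k n y) (nhds x)"
    using eventually_nhds_in_open[of "{0<..}" x] Suc.prems
    by (auto elim!: eventually_mono simp: Suc.IH)
  then have "deriv ((deriv ^^ n) (\<lambda>y. y ^ k * rho \<nu> y)) x = deriv (power_rho_deriv \<nu> k n) x"
    by (rule deriv_cong_ev) simp
  then show ?case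
    using DERIV_imp_deriv[OF power_rho_deriv_has_derivative[OF Suc.prems]] by simp
qed

definition rodrigues_term :: "real \<Rightarrow> nat \<Rightarrow> real \<Rightarrow> real" where
  "rodrigues_term \<nu> k x = power_rho_deriv \<nu> k k x / fact k"

text \<open>\<open>D\<^sup>k x\<^sup>k / k!\<close> is the binomial coefficient \<open>(\<vartheta> + k) choose k\<close> in \<open>\<vartheta> = x D\<close>.\<close>
lemma rodrigues_term_deriv:
  assumes "x > 0"
  shows "(rodrigues_term \<nu> k has_real_derivative
     real (Suc k) * (rodrigues_term \<nu> (Suc k) x - rodrigues_term \<nu> k x) / x) (at x)"
proof -
  have "(rodrigues_term \<nu> k has_real_derivative power_rho_deriv \<nu> k (Suc k) x / fact k) (at x)"
    unfolding rodrigues_term_def[abs_def]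
    by (intro DERIV_cdivide power_rho_deriv_has_derivative assms)
  \<comment> \<open>One unfolding of the Leibniz clause at derivative order \<open>Suc k\<close>,
    with \<open>k\<close> as the power; solving it for the derivative gives the claim.\<close>
  moreover have "real (Suc k) * rodrigues_term \<nu> (Suc k) x =
      (x * power_rho_deriv \<nu> k (Suc k) x + real (Suc k) * power_rho_deriv \<nu> k k x) / fact k"
    by (simp add: rodrigues_term_def del: of_nat_Suc)
  then have "real (Suc k) * (rodrigues_term \<nu> (Suc k) x - rodrigues_term \<nu> k x) / x =
      power_rho_deriv \<nu> k (Suc k) x / fact k"
    using assms by (simp add: right_diff_distrib add_divide_distrib rodrigues_term_def del: of_nat_Suc)
  ultimately show ?thesis by simp
qed

text \<open>The coefficients \<open>newton_diff g k\<close> are those of Newton's interpolation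
  polynomial in \<open>\<vartheta> = x D\<close> with value \<open>g j\<close> at
  \<open>\<vartheta> = - 1 - j\<close>. There \<open>c - \<vartheta>\<close> equals
  \<open>c + 1 + j\<close>, so applying this operator multiplies \<open>g\<close> by that factor and
  raises the degree by one.\<close>

lemma rodrigues_sum_step:
  assumes F: "\<And>x. x > 0 \<Longrightarrow> F x = (\<Sum>k\<le>N. newton_diff g k * rodrigues_term \<nu> k x)"
    and g: "\<And>k. k > N \<Longrightarrow> newton_diff g k = 0"
    and F': "\<And>x. x > 0 \<Longrightarrow> (F has_real_derivative F' x) (at x)" and x: "x > 0"
  shows "c * F x - x * F' x =
     (\<Sum>k\<le>Suc N. newton_diff (\<lambda>j. (c + 1 + real j) * g j) k * rodrigues_term \<nu> k x)"
proof -
  let ?E = "\<lambda>k. rodrigues_term \<nu> k x"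
  have "((\<lambda>x. \<Sum>k\<le>N. newton_diff g k * rodrigues_term \<nu> k x) has_real_derivative
      (\<Sum>k\<le>N. newton_diff g k * (real (Suc k) * (?E (Suc k) - ?E k) / x))) (at x)"
    by (intro DERIV_sum DERIV_cmult rodrigues_term_deriv x)
  then have "(F has_real_derivative
      (\<Sum>k\<le>N. newton_diff g k * (real (Suc k) * (?E (Suc k) - ?E k) / x))) (at x)"
    by (rule has_field_derivative_transform_within_open[where S = "{0<..}"]) (use x F in auto)
  from DERIV_unique[OF F'[OF x] this]
  have xF': "x * F' x = (\<Sum>k\<le>N. newton_diff g k * (real (Suc k) * (?E (Suc k) - ?E k)))"
    using x by (simp add: sum_distrib_left)
  have "(\<Sum>k\<le>Suc N. newton_diff (\<lambda>j. (c + 1 + real j) * g j) k * ?E k) =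
      (\<Sum>k\<le>Suc N. (c + 1 + real k) * newton_diff g k * ?E k) -
      (\<Sum>k\<le>Suc N. real k * newton_diff g (k - 1) * ?E k)"
    unfolding newton_diff_mult_affine sum_subtractf[symmetric] by (simp only: left_diff_distrib)
  also have "(\<Sum>k\<le>Suc N. (c + 1 + real k) * newton_diff g k * ?E k) =
      (\<Sum>k\<le>N. (c + 1 + real k) * newton_diff g k * ?E k)"
    using g[of "Suc N"] by simp
  also have "(\<Sum>k\<le>Suc N. real k * newton_diff g (k - 1) * ?E k) =
      (\<Sum>k\<le>N. real (Suc k) * newton_diff g k * ?E (Suc k))"
    by (subst sum.atMost_Suc_shift) simp
  also have "(\<Sum>k\<le>N. (c + 1 + real k) * newton_diff g k * ?E k) -
      (\<Sum>k\<le>N. real (Suc k) * newton_diff g k * ?E (Suc k)) = c * F x - x * F' x"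
    unfolding xF' F[OF x] sum_distrib_left sum_subtractf[symmetric]
    by (intro sum.cong refl) (simp add: algebra_simps)
  finally show ?thesis by simp
qed

text \<open>Passing from \<open>r\<close> to \<open>Suc r\<close> takes two first-order steps. The
  operator \<open>r - \<vartheta>\<close> sends \<open>x ^ r * rho \<nu> x\<close> to
  \<open>x ^ Suc r * rho (\<nu> - 1) x\<close>, and \<open>r + \<nu> - \<vartheta>\<close> restores
  the index by the recurrence for \<open>rho\<close>. The two Pochhammer symbols gain one factor
  each.\<close>

lemma power_rho_eq_rodrigues_sum:
  assumes "x > 0"
  shows "x ^ r * rho \<nu> x = (\<Sum>k\<le>2 * r.
     newton_diff (\<lambda>j. pochhammer (1 + \<nu> + real j) r * pochhammer (1 + real j) r) k * rodrigues_term \<nu> k x)"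
proof -
  define g where "g r j = pochhammer (1 + \<nu> + real j) r * pochhammer (1 + real j) r" for r j
  \<comment> \<open>The vanishing of higher differences is carried along because each operator step
    requires it.\<close>
  have "(\<forall>k>2 * r. newton_diff (g r) k = 0) \<and>
      (\<forall>x>0. x ^ r * rho \<nu> x = (\<Sum>k\<le>2 * r. newton_diff (g r) k * rodrigues_term \<nu> k x))"
  proof (induction r)
    case 0
    show ?case by (simp add: g_def newton_diff_const rodrigues_term_def)
  next
    case (Suc r)
    define h where "h j = (real r + 1 + real j) * g r j" for j
    have gs: "g (Suc r) = (\<lambda>j. (real r + \<nu> + 1 + real j) * h j)"
      by (auto simp: g_def h_def pochhammer_Suc algebra_simps)
    have h0: "newton_diff h k = 0" if "k > Suc (2 * r)" for k
      using Suc.IH that newton_diff_mult_affine[of "real r + 1" "g r" k] by (auto simp: h_def[abs_def])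
    have g0: "newton_diff (g (Suc r)) k = 0" if "k > 2 * Suc r" for k
      using that h0[of k] h0[of "k - 1"] newton_diff_mult_affine[of "real r + \<nu> + 1" h k] by (auto simp: gs)
    define F where "F x = x ^ Suc r * rho (\<nu> - 1) x" for x
    have F: "F x = (\<Sum>k\<le>Suc (2 * r). newton_diff h k * rodrigues_term \<nu> k x)" if x: "x > 0" for x
    proof -
      have "real r * (x ^ r * rho \<nu> x) - x * (real r * x ^ (r - 1) * rho \<nu> x + x ^ r * - rho (\<nu> - 1) x) =
          (\<Sum>k\<le>Suc (2 * r). newton_diff (\<lambda>j. (real r + 1 + real j) * g r j) k * rodrigues_term \<nu> k x)"
      proof (rule rodrigues_sum_step[where F = "\<lambda>x. x ^ r * rho \<nu> x"])
        show "((\<lambda>x. x ^ r * rho \<nu> x) has_real_derivative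
            real r * y ^ (r - 1) * rho \<nu> y + y ^ r * - rho (\<nu> - 1) y) (at y)" if "y > 0" for y
          using that by (auto intro!: derivative_eq_intros rho_deriv)
      qed (use Suc.IH x in auto)
      \<comment> \<open>Stated with the factor \<open>real r\<close> so that it also holds for
        \<open>r = 0\<close>, where \<open>r - 1\<close> is truncated.\<close>
      moreover have "real r * x ^ r = x * (real r * x ^ (r - 1))"
        by (cases r) auto
      then have "real r * (x ^ r * rho \<nu> x) - x * (real r * x ^ (r - 1) * rho \<nu> x + x ^ r * - rho (\<nu> - 1) x) = F x"
        by (auto simp: F_def algebra_simps)
      ultimately show ?thesis unfolding h_def[abs_def] by simp
    qed
    have "x ^ Suc r * rho \<nu> x = (\<Sum>k\<le>2 * Suc r. newton_diff (g (Suc r)) k * rodrigues_term \<nu> k x)"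
      if x: "x > 0" for x
    proof -
      have "(real r + \<nu>) * F x - x * (real (Suc r) * x ^ r * rho (\<nu> - 1) x + x ^ Suc r * - rho (\<nu> - 1 - 1) x) =
          (\<Sum>k\<le>Suc (Suc (2 * r)). newton_diff (\<lambda>j. (real r + \<nu> + 1 + real j) * h j) k * rodrigues_term \<nu> k x)"
      proof (rule rodrigues_sum_step[where F = F])
        show "(F has_real_derivative
            real (Suc r) * y ^ r * rho (\<nu> - 1) y + y ^ Suc r * - rho (\<nu> - 1 - 1) y) (at y)" if "y > 0" for y
        proof -
          have "((\<lambda>x. x ^ Suc r) has_real_derivative real (Suc r) * y ^ r) (at y)"
            using DERIV_pow[of "Suc r" y] by simp
          from DERIV_mult[OF this rho_deriv[OF that, of "\<nu> - 1"]]
          show ?thesis unfolding F_def[abs_def] by (simp add: algebra_simps)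
        qed
      qed (use F h0 x in auto)
      moreover have "(real r + \<nu>) * F x - x * (real (Suc r) * x ^ r * rho (\<nu> - 1) x + x ^ Suc r * - rho (\<nu> - 1 - 1) x)
          = x ^ Suc r * ((\<nu> - 1) * rho (\<nu> - 1) x + x * rho (\<nu> - 1 - 1) x)"
        by (simp add: F_def algebra_simps)
      moreover have "(\<nu> - 1) * rho (\<nu> - 1) x + x * rho (\<nu> - 1 - 1) x = rho \<nu> x"
        using rho_contiguous[OF x, of "\<nu> - 1"] by simp
      ultimately show ?thesis by (simp add: gs)
    qed
    with g0 show ?case by blast
  qed
  then show ?thesis using assms by (simp add: g_def[abs_def])
qed

text \<open>The factor \<open>pochhammer (- k) j / j!\<close> is a signed binomial coefficient and
  ends the series at \<open>k\<close>. The prefactor exchanges \<open>r\<close> and \<open>j\<close>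
  in the Pochhammer quotients, which thereby become polynomials in \<open>j\<close>.\<close>

lemma hypergeometric_3F2_newton_diff:
  assumes "\<nu> > - 1"
  shows "fact r * pochhammer (1 + \<nu>) r *
      hypergeometric_F [- of_nat k, 1 + \<nu> + of_nat r, 1 + of_nat r] [1 + \<nu>, 1] 1 =
    newton_diff (\<lambda>j. pochhammer (1 + \<nu> + real j) r * pochhammer (1 + real j) r) k"
proof -
  have swap: "pochhammer (z + real r) j * pochhammer z r = pochhammer z j * pochhammer (z + real j) r" for z :: real and j
    using pochhammer_product'[of z r j] pochhammer_product'[of z j r]
    by (simp add: add.commute mult.commute)
  have "hypergeometric_F [- of_nat k, 1 + \<nu> + of_nat r, 1 + of_nat r] [1 + \<nu>, 1] 1 =
     (\<Sum>j\<le>k. pochhammer (- real k) j * pochhammer (1 + \<nu> + real r) j * pochhammer (1 + real r) j /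
        (pochhammer (1 + \<nu>) j * pochhammer 1 j) / fact j)"
    unfolding hypergeometric_F_def
    by (subst suminf_finite[of "{..k}"]) (auto simp: pochhammer_of_nat_eq_0_iff mult.assoc)
  moreover have "fact r * pochhammer (1 + \<nu>) r * (pochhammer (- real k) j * pochhammer (1 + \<nu> + real r) j *
        pochhammer (1 + real r) j / (pochhammer (1 + \<nu>) j * pochhammer 1 j) / fact j) =
      (- 1) ^ j * real (k choose j) * (pochhammer (1 + \<nu> + real j) r * pochhammer (1 + real j) r)" for j
  proof -
    have p: "pochhammer (1 + \<nu>) j \<noteq> 0" "pochhammer (1::real) j \<noteq> 0"
      using assms pochhammer_pos[of "1 + \<nu>" j] pochhammer_pos[of "1::real" j] by auto
    have "pochhammer (- real k) j = (- 1) ^ j * real (k choose j) * fact j"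
      using gbinomial_pochhammer[of "real k" j] by (simp add: binomial_gbinomial)
    then have a: "pochhammer (- real k) j / fact j = (- 1) ^ j * real (k choose j)"
      by simp
    have b: "pochhammer (1 + \<nu> + real r) j * pochhammer (1 + \<nu>) r / pochhammer (1 + \<nu>) j =
        pochhammer (1 + \<nu> + real j) r"
      using swap[of "1 + \<nu>" j] p by simp
    have c: "pochhammer (1 + real r) j * fact r / pochhammer 1 j = pochhammer (1 + real j) r"
      using swap[of 1 j] p by (simp add: pochhammer_fact)
    have "fact r * pochhammer (1 + \<nu>) r * (pochhammer (- real k) j * pochhammer (1 + \<nu> + real r) j *
        pochhammer (1 + real r) j / (pochhammer (1 + \<nu>) j * pochhammer 1 j) / fact j) =
      (pochhammer (- real k) j / fact j) *
        ((pochhammer (1 + \<nu> + real r) j * pochhammer (1 + \<nu>) r / pochhammer (1 + \<nu>) j) *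
         (pochhammer (1 + real r) j * fact r / pochhammer 1 j))"
      by (simp add: mult_ac)
    then show ?thesis unfolding a b c .
  qed
  ultimately show ?thesis by (simp add: newton_diff_def sum_distrib_left)
qed

lemma power_rho_eq_hypergeometric_sum:
  assumes "\<nu> > - 1" "x > 0"
  shows "fact r * pochhammer (1 + \<nu>) r * (\<Sum>k\<le>2 * r. 1 / fact k * (deriv ^^ k) (\<lambda>y. y ^ k * rho \<nu> y) x *
       hypergeometric_F [- of_nat k, 1 + \<nu> + of_nat r, 1 + of_nat r] [1 + \<nu>, 1] 1) = x ^ r * rho \<nu> x"
  unfolding power_rho_eq_rodrigues_sum[OF assms(2)] sum_distrib_left
    hypergeometric_3F2_newton_diff[OF assms(1), symmetric] deriv_funpow_power_rho[OF assms(2)]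
  by (intro sum.cong refl) (simp add: rodrigues_term_def)

section \<open>The coefficients as moments of the squared weight\<close>

lemma moment_functional_monom: "moment_functional J (monom c i) = c * J i"
  by (subst moment_functional_le[OF degree_monom_le]) (simp add: coeff_monom mult_delta_left)

lemma moment_functional_halfline_integral:
  assumes "\<And>a. (\<lambda>t. t ^ a * W t) has_halfline_integral J a"
  shows "(\<lambda>t. poly p t * W t) has_halfline_integral moment_functional J p"
proof -
  have "(\<lambda>t. \<Sum>i\<le>degree p. coeff p i * (t ^ i * W t)) has_halfline_integral moment_functional J p"
    unfolding moment_functional_def by (intro halfline_integral_sum halfline_integral_cmult assms)
  then show ?thesis
    by (simp add: poly_altdef sum_distrib_right mult.assoc)
qed

lemma Gamma_plus1_real: "x > (0::real) \<Longrightarrow> Gamma (x + 1) = x * Gamma x"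
  using Gamma_add_of_nat[of x 1] by simp

text \<open>This is integration by parts against the weight, checked on the closed form so that no
  boundary terms occur. After a common Gamma quotient is split off, a rational identity in the
  parameters remains.\<close>

lemma theta_moment_Suc:
  assumes "\<nu> > - 1 / 2"
  shows "theta_moment \<nu> (Suc k) a =
     theta_moment \<nu> k (a + 2) - (\<nu> + 1 + real a) * theta_moment \<nu> k (a + 1)"
proof -
  define A B C D where "A = Gamma (2 * \<nu> + real k + real a + 2)" and "B = Gamma (\<nu> + real k + real a + 2)"
    and "C = Gamma (\<nu> + real k + 1)" and "D = Gamma (2 * \<nu> + 2 * real k + real a + 3)"
  have D: "D > 0" and q: "2 * \<nu> + 2 * real k + real a + 3 > 0" and G: "Gamma (\<nu> + 1) > 0"
    using assms by (auto simp: D_def)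
  have A': "Gamma (2 * \<nu> + real k + real a + 3) = (2 * \<nu> + real k + real a + 2) * A"
    using assms Gamma_plus1_real[of "2 * \<nu> + real k + real a + 2"] by (simp add: A_def add.commute)
  have B': "Gamma (\<nu> + real k + real a + 3) = (\<nu> + real k + real a + 2) * B"
    using assms Gamma_plus1_real[of "\<nu> + real k + real a + 2"] by (simp add: B_def add.commute)
  have C': "Gamma (\<nu> + real k + 2) = (\<nu> + real k + 1) * C"
    using assms Gamma_plus1_real[of "\<nu> + real k + 1"] by (simp add: C_def add.commute)
  have D': "Gamma (2 * \<nu> + 2 * real k + real a + 4) = (2 * \<nu> + 2 * real k + real a + 3) * D"
    using assms Gamma_plus1_real[of "2 * \<nu> + 2 * real k + real a + 3"] by (simp add: D_def add.commute)
  have 1: "theta_moment \<nu> (Suc k) a = fact k * A * B * C / (Gamma (\<nu> + 1) * D) *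
      ((real k + 1) * (\<nu> + real k + 1) / (2 * \<nu> + 2 * real k + real a + 3))"
  proof -
    have "theta_moment \<nu> (Suc k) a = fact (Suc k) * Gamma (2 * \<nu> + real k + real a + 2) *
        Gamma (\<nu> + real k + real a + 2) * Gamma (\<nu> + real k + 2) /
        (Gamma (\<nu> + 1) * Gamma (2 * \<nu> + 2 * real k + real a + 4))"
      by (simp add: theta_moment_def algebra_simps)
    then show ?thesis unfolding C' D' A_def[symmetric] B_def[symmetric] by (simp add: mult_ac)
  qed
  have 2: "theta_moment \<nu> k (a + 2) = fact k * A * B * C / (Gamma (\<nu> + 1) * D) *
      ((2 * \<nu> + real k + real a + 2) * (\<nu> + real k + real a + 2) / (2 * \<nu> + 2 * real k + real a + 3))"
  proof -
    have "theta_moment \<nu> k (a + 2) = fact k * Gamma (2 * \<nu> + real k + real a + 3) *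
        Gamma (\<nu> + real k + real a + 3) * Gamma (\<nu> + real k + 1) /
        (Gamma (\<nu> + 1) * Gamma (2 * \<nu> + 2 * real k + real a + 4))"
      by (simp add: theta_moment_def algebra_simps)
    then show ?thesis unfolding A' B' D' C_def[symmetric] by (simp add: mult_ac)
  qed
  have 3: "theta_moment \<nu> k (a + 1) = fact k * A * B * C / (Gamma (\<nu> + 1) * D)"
    unfolding theta_moment_def A_def B_def C_def D_def by (simp add: algebra_simps)
  have "(real k + 1) * (\<nu> + real k + 1) / (2 * \<nu> + 2 * real k + real a + 3) =
      (2 * \<nu> + real k + real a + 2) * (\<nu> + real k + real a + 2) / (2 * \<nu> + 2 * real k + real a + 3)
        - (\<nu> + 1 + real a)"
    using q by (simp add: divide_simps) (simp add: algebra_simps)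
  then show ?thesis unfolding 1 2 3 by (simp add: right_diff_distrib mult_ac)
qed

section \<open>Evaluation of the coefficients c, d and f\<close>

lemma coef_c_eq:
  assumes "\<nu> > - 1 / 2"
  shows "coef_c \<nu> k r =
     fact r / Gamma (1 + \<nu> + real r) * moment_functional (theta_moment \<nu> k) (laguerre_poly \<nu> r)"
proof -
  let ?W = "\<lambda>t. t powr \<nu> * exp (- t) * (theta ^^ k) (\<lambda>s. s powr \<nu> * exp s * inc_Gamma (- \<nu>) s) t"
  have "(\<lambda>t. poly (laguerre_poly \<nu> r) t * ?W t) has_halfline_integral
      moment_functional (theta_moment \<nu> k) (laguerre_poly \<nu> r)"
    by (rule moment_functional_halfline_integral, rule halfline_integral_transform,
        rule theta_moment_integral[OF assms]) (simp_all add: mult_ac)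
  from halfline_integral_eq[OF this] show ?thesis
    by (simp add: coef_c_def poly_laguerre_poly mult_ac)
qed

lemma coef_d_eq:
  assumes "\<nu> > - 1"
  shows "coef_d \<nu> m r = moment_functional (\<lambda>i. Gamma (\<nu> + real i + 1))
     (monom 1 m * laguerre_poly \<nu> m * laguerre_poly \<nu> r)"
proof -
  have "(\<lambda>t. t ^ a * (t powr \<nu> * exp (- t))) has_halfline_integral Gamma (\<nu> + real a + 1)" for a
    by (rule halfline_integral_transform[OF halfline_Gamma[of "\<nu> + real a + 1" 1]])
       (use assms in \<open>auto simp: powr_add powr_realpow\<close>)
  from moment_functional_halfline_integral[OF this, of "monom 1 m * laguerre_poly \<nu> m * laguerre_poly \<nu> r"]
  have "(\<lambda>t. t powr (\<nu> + real m) * exp (- t) * laguerre \<nu> m t * laguerre \<nu> r t) has_halfline_integral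
      moment_functional (\<lambda>i. Gamma (\<nu> + real i + 1)) (monom 1 m * laguerre_poly \<nu> m * laguerre_poly \<nu> r)"
    by (rule halfline_integral_transform)
       (auto simp: poly_laguerre_poly poly_monom powr_add powr_realpow)
  then show ?thesis by (simp add: coef_d_def halfline_integral_eq)
qed

text \<open>The summation bound \<open>2 * m\<close> is the degree of \<open>t ^ m * L_m\<close>, so
  its Laguerre expansion is complete and the Rodrigues lemma applies. Up to a nonzero factor for
  each row, the \<open>coef_f\<close> thus form a Hankel matrix of moments of
  \<open>rho\<^sup>2\<close>.\<close>

lemma coef_f_eq:
  assumes \<nu>: "\<nu> > - 1 / 2"
  shows "coef_f \<nu> k m = (- 1) ^ m / (fact m * Gamma (\<nu> + 1)) * rho_moment \<nu> (m + k)"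
proof -
  have \<nu>1: "\<nu> > - 1" using \<nu> by simp
  have "coef_f \<nu> k m = moment_functional (theta_moment \<nu> k) (monom 1 m * laguerre_poly \<nu> m)"
    unfolding coef_f_def coef_c_eq[OF \<nu>] coef_d_eq[OF \<nu>1]
    by (rule laguerre_expansion_functional[OF \<nu>1], rule order.trans[OF degree_mult_le])
       (simp add: degree_laguerre_poly degree_monom_eq)
  also have "\<dots> = (- 1) ^ m / fact m * theta_moment \<nu> (k + m) 0"
    by (rule moment_functional_rodrigues, rule theta_moment_Suc[OF \<nu>])
  also have "\<dots> = (- 1) ^ m / (fact m * Gamma (\<nu> + 1)) * rho_moment \<nu> (m + k)"
    by (simp add: theta_moment_def rho_moment_def power2_eq_square add_ac)
  finally show ?thesis .
qed

section \<open>Positivity and closed form of the moments\<close>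

lemma rho_moment_functional_integral:
  assumes "\<nu> > - 1 / 2"
  shows "(\<lambda>x. poly p x * (rho \<nu> x)\<^sup>2) has_halfline_integral moment_functional (rho_moment \<nu>) p"
  by (intro moment_functional_halfline_integral rho_moment_integral assms)

lemma rho_moment_functional_pos:
  assumes "\<nu> > - 1 / 2" "p \<noteq> 0" "\<And>x. x > 0 \<Longrightarrow> poly p x \<ge> 0"
  shows "moment_functional (rho_moment \<nu>) p > 0"
proof (rule halfline_integral_pos[OF rho_moment_functional_integral[OF assms(1)]])
  have "{t. t > 0 \<and> poly p t * (rho \<nu> t)\<^sup>2 = 0} \<subseteq> {t. poly p t = 0}"
    using rho_pos[of _ \<nu>] by (auto simp: order_less_le)
  then show "finite {t. t > 0 \<and> poly p t * (rho \<nu> t)\<^sup>2 = 0}"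
    by (rule finite_subset) (rule poly_roots_finite[OF assms(2)])
qed (use assms(3) in auto)

text \<open>Legendre's duplication formula at \<open>z = \<nu> + j + 1\<close> trades
  \<open>Gamma (2 * z)\<close> for \<open>Gamma (z + 1 / 2)\<close>, the source of
  \<open>\<nu> + 3 / 2\<close>, of \<open>sqrt pi\<close> and of the powers of 2.\<close>

lemma rho_moment_eq:
  assumes \<nu>: "\<nu> > - 1 / 2"
  shows "rho_moment \<nu> j =
     sqrt pi * (Gamma (1 + 2 * \<nu>) * Gamma (1 + \<nu>) / (2 powr (1 + 2 * \<nu>) * Gamma (\<nu> + 3 / 2))) *
     (fact j * (pochhammer (1 + 2 * \<nu>) j * pochhammer (1 + \<nu>) j / (4 ^ j * pochhammer (\<nu> + 3 / 2) j)))"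
proof -
  define z where "z = \<nu> + real j + 1"
  have z: "z > 0" using \<nu> by (simp add: z_def)
  have dup: "Gamma z * Gamma (z + 1 / 2) = 2 powr (1 - 2 * z) * sqrt pi * Gamma (2 * z)"
  proof -
    have nonpos: "complex_of_real x \<notin> \<int>\<^sub>\<le>\<^sub>0" if "x > 0" for x
      using that by (auto elim!: nonpos_Ints_cases simp: complex_eq_iff)
    have half: "complex_of_real z + 1 / 2 = complex_of_real (z + 1 / 2)" by simp
    have "complex_of_real (Gamma z * Gamma (z + 1 / 2)) =
        exp ((1 - 2 * complex_of_real z) * complex_of_real (ln 2)) * complex_of_real (sqrt pi) *
        Gamma (2 * complex_of_real z)"
      using Gamma_legendre_duplication[of "complex_of_real z"] nonpos[of z] nonpos[of "z + 1 / 2"] z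
      unfolding half Gamma_complex_of_real by simp
    also have "\<dots> = complex_of_real (2 powr (1 - 2 * z) * sqrt pi * Gamma (2 * z))"
      by (simp add: powr_def exp_of_real[symmetric] Gamma_complex_of_real[symmetric])
    finally show ?thesis by (simp only: of_real_eq_iff)
  qed
  have "2 powr (1 - 2 * z) = 1 / (2 powr (1 + 2 * \<nu>) * 4 ^ j)"
  proof -
    have "2 powr (1 - 2 * z) = 2 powr (- (1 + 2 * \<nu>) - real (2 * j))"
      by (simp add: z_def algebra_simps)
    also have "\<dots> = 2 powr (- (1 + 2 * \<nu>)) / 2 ^ (2 * j)"
      by (subst powr_diff) (simp only: powr_realpow zero_less_numeral)
    also have "\<dots> = 1 / (2 powr (1 + 2 * \<nu>) * 4 ^ j)"
      by (simp add: powr_minus_divide power_mult del: minus_add_distrib)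
    finally show ?thesis .
  qed
  note pw = this
  have pos: "Gamma (2 * z) > 0" "Gamma (z + 1 / 2) > 0" using z by auto
  have G2z: "Gamma z / Gamma (2 * z) = sqrt pi / (2 powr (1 + 2 * \<nu>) * 4 ^ j * Gamma (z + 1 / 2))"
  proof -
    have "g / G = s / (K * h)" if "g * h = 1 / K * s * G" "K > 0" "G > 0" "h > 0" for g G h s K :: real
      using that by (simp add: field_simps)
    from this[OF dup[unfolded pw] _ pos] show ?thesis by simp
  qed
  have "rho_moment \<nu> j = fact j * Gamma (1 + 2 * \<nu> + real j) * Gamma z * (Gamma z / Gamma (2 * z))"
    by (simp add: rho_moment_def z_def power2_eq_square algebra_simps)
  also have "\<dots> = fact j * (pochhammer (1 + 2 * \<nu>) j * Gamma (1 + 2 * \<nu>)) * (pochhammer (1 + \<nu>) j * Gamma (1 + \<nu>)) *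
      (sqrt pi / (2 powr (1 + 2 * \<nu>) * 4 ^ j * (pochhammer (\<nu> + 3 / 2) j * Gamma (\<nu> + 3 / 2))))"
  proof -
    have "Gamma (1 + 2 * \<nu> + real j) = pochhammer (1 + 2 * \<nu>) j * Gamma (1 + 2 * \<nu>)"
      by (rule Gamma_add_of_nat) (use \<nu> in simp)
    moreover have "Gamma z = pochhammer (1 + \<nu>) j * Gamma (1 + \<nu>)"
      using Gamma_add_of_nat[of "1 + \<nu>" j] \<nu> by (simp add: z_def add_ac)
    moreover have "Gamma (z + 1 / 2) = pochhammer (\<nu> + 3 / 2) j * Gamma (\<nu> + 3 / 2)"
      using Gamma_add_of_nat[of "\<nu> + 3 / 2" j] \<nu> by (simp add: z_def add_ac)
    ultimately show ?thesis unfolding G2z by simp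
  qed
  finally show ?thesis by (simp add: mult_ac)
qed

text \<open>The coefficients of \<open>P n\<close> are proportional to the \<open>det_Dk\<close>, so
  \<open>norm_S\<close> is, up to that factor, the integral of \<open>x ^ n\<close> times
  \<open>P n\<close> against \<open>rho\<^sup>2\<close>.\<close>

lemma norm_S_eq:
  assumes "\<nu> > - 1 / 2"
  shows "norm_S \<nu> n = (\<Sum>k\<le>n. det_Dk \<nu> n k * rho_moment \<nu> (n + k))"
  unfolding norm_S_def rho_moment_eq[OF assms] sum_distrib_left
  by (intro sum.cong refl) (simp only: mult_ac)

text \<open>In the Laplace expansion along column \<open>k\<close> the cofactors do not see the
  replaced column.\<close>

lemma det_replace_col_smult:
  fixes A :: "real Matrix.mat"
  assumes A: "A \<in> carrier_mat n n" and k: "k < n"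
  shows "Determinant.det (replace_col A (Matrix.vec n (\<lambda>m. c * w m)) k) =
     c * Determinant.det (replace_col A (Matrix.vec n w) k)"
proof -
  have carrier: "replace_col A b k \<in> carrier_mat n n" for b
    using A by (simp add: replace_col_def)
  have cof: "cofactor (replace_col A b k) i k = cofactor A i k" if "i < n" for b i
    unfolding cofactor_def using A k that
    by (intro arg_cong2[where f = "(*)"] refl arg_cong[where f = Determinant.det] eq_matI)
       (auto simp: mat_delete_def replace_col_def)
  show ?thesis
    unfolding laplace_expansion_column[OF carrier k] sum_distrib_left
    using A k by (intro sum.cong refl) (auto simp: cof, auto simp: replace_col_def)
qed

lemma moment_functional_monom_mult_sum:
  "moment_functional J (monom 1 a * (\<Sum>j<n. monom (v j) j)) = (\<Sum>j<n. v j * J (a + j))"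
  by (simp add: sum_distrib_left mult_monom moment_functional_sum moment_functional_monom)

text \<open>A kernel vector gives a nonzero polynomial \<open>p\<close> of degree below
  \<open>n\<close>. As the columns start at index 1, \<open>p\<close> is orthogonal to all powers
  below \<open>n\<close> for the weight \<open>x * rho\<^sup>2\<close>, hence to itself, against
  positivity.\<close>

lemma det_D_nonzero:
  assumes \<nu>: "\<nu> > - 1 / 2"
  shows "det_D \<nu> n \<noteq> 0"
proof
  let ?M = "moment_functional (rho_moment \<nu>)"
  have A: "f_matrix \<nu> n \<in> carrier_mat n n" by (simp add: f_matrix_def)
  assume "det_D \<nu> n = 0"
  then obtain v where v: "v \<in> carrier_vec n" "v \<noteq> 0\<^sub>v n" and Av: "f_matrix \<nu> n *\<^sub>v v = 0\<^sub>v n"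
    using det_0_iff_vec_prod_zero_field[OF A] by (auto simp: det_D_def)
  define w where "w j = vec_index v j" for j
  define p where "p = (\<Sum>j<n. monom (w j) j)"
  have G: "Gamma (\<nu> + 1) > 0" using \<nu> by simp
  have orth: "?M (monom 1 (Suc m) * p) = 0" if m: "m < n" for m
  proof -
    have "0 = vec_index (f_matrix \<nu> n *\<^sub>v v) m" using Av m by simp
    also have "\<dots> = (\<Sum>j<n. coef_f \<nu> (Suc j) m * w j)"
      using m v(1) by (simp add: f_matrix_def scalar_prod_def w_def atLeast0LessThan)
    also have "\<dots> = (- 1) ^ m / (fact m * Gamma (\<nu> + 1)) * (\<Sum>j<n. w j * rho_moment \<nu> (Suc m + j))"
      by (simp add: coef_f_eq[OF \<nu>] sum_distrib_left mult_ac)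
    finally have "(\<Sum>j<n. w j * rho_moment \<nu> (Suc m + j)) = 0" using G by simp
    then show ?thesis unfolding p_def moment_functional_monom_mult_sum .
  qed
  obtain j where j: "j < n" "w j \<noteq> 0"
    using v by (metis eq_vecI carrier_vecD index_zero_vec w_def)
  have "coeff p j = w j" using j by (simp add: p_def coeff_sum coeff_monom)
  then have p: "p \<noteq> 0" using j by auto
  have "?M (monom 1 1 * p * p) > 0"
    using p by (intro rho_moment_functional_pos \<nu>) (auto simp: poly_monom mult.assoc)
  moreover have "monom 1 1 * p * p = (\<Sum>m<n. Polynomial.smult (w m) (monom 1 (Suc m) * p))"
  proof -
    have "monom 1 1 * p = (\<Sum>m<n. Polynomial.smult (w m) (monom 1 (Suc m)))"
      by (simp add: p_def sum_distrib_left mult_monom smult_monom)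
    from arg_cong[OF this, of "\<lambda>q. q * p"] show ?thesis by (simp add: sum_distrib_right)
  qed
  ultimately show False
    by (simp add: moment_functional_sum moment_functional_smult orth)
qed

section \<open>Orthonormal polynomials\<close>

text \<open>For \<open>m < n\<close> the power \<open>x ^ m\<close> lies in the span of the
  polynomials of lower index. In the normalization of \<open>P n\<close> therefore only the leading
  term of one factor contributes.\<close>

lemma orthonormal_coeffs:
  fixes P :: "nat \<Rightarrow> real poly"
  assumes \<nu>: "\<nu> > - 1 / 2"
    and deg: "\<And>m. degree (P m) = m" and lead: "\<And>m. coeff (P m) m > 0"
    and orth: "\<And>m l. moment_functional (rho_moment \<nu>) (P m * P l) = (if m = l then 1 else 0)"
  shows "m < n \<Longrightarrow> (\<Sum>k\<le>n. coeff (P n) k * rho_moment \<nu> (m + k)) = 0"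
    and "(\<Sum>k\<le>n. coeff (P n) k * rho_moment \<nu> (n + k)) = 1 / coeff (P n) n"
proof -
  let ?M = "moment_functional (rho_moment \<nu>)"
  have M_monom: "?M (monom 1 m * P n) = (\<Sum>k\<le>n. coeff (P n) k * rho_moment \<nu> (m + k))" for m
    unfolding moment_functional_monom_mult by (simp add: moment_functional_def deg add.commute)
  have low: "?M (monom 1 m * P n) = 0" if "m < n" for m
  proof -
    obtain c where c: "monom 1 m = (\<Sum>l\<le>m. Polynomial.smult (c l) (P l))"
      using poly_eq_sum_smult_basis[of P "monom 1 m" m] deg lead
      by (metis degree_monom_le less_irrefl)
    show ?thesis using that
      by (simp add: c sum_distrib_right moment_functional_sum moment_functional_smult orth)
  qed
  then show "m < n \<Longrightarrow> (\<Sum>k\<le>n. coeff (P n) k * rho_moment \<nu> (m + k)) = 0"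
    by (simp add: M_monom)
  have "P n = (\<Sum>i\<le>n. Polynomial.smult (coeff (P n) i) (monom 1 i))"
    using poly_as_sum_of_monoms[of "P n"] by (simp add: deg smult_monom)
  from arg_cong[OF this, of "\<lambda>q. ?M (q * P n)"]
  have "1 = (\<Sum>i\<le>n. coeff (P n) i * ?M (monom 1 i * P n))"
    by (simp add: orth sum_distrib_right moment_functional_sum moment_functional_smult)
  also have "\<dots> = (\<Sum>i\<in>{n}. coeff (P n) i * ?M (monom 1 i * P n))"
    using low by (intro sum.mono_neutral_right) auto
  finally show "(\<Sum>k\<le>n. coeff (P n) k * rho_moment \<nu> (n + k)) = 1 / coeff (P n) n"
    unfolding M_monom[of n, symmetric] using lead[of n] by (simp add: field_simps)
qed

text \<open>The orthogonality relations, with the constant term taken to the right, form a regular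
  linear system for the remaining coefficients, solved by Cramer's rule. The convention for
  \<open>det_Dk\<close> at 0 makes the formula hold for \<open>k = 0\<close> too.\<close>

lemma orthonormal_coeff_det:
  fixes P :: "nat \<Rightarrow> real poly"
  assumes \<nu>: "\<nu> > - 1 / 2"
    and deg: "\<And>m. degree (P m) = m" and lead: "\<And>m. coeff (P m) m > 0"
    and orth: "\<And>m l. moment_functional (rho_moment \<nu>) (P m * P l) = (if m = l then 1 else 0)"
    and k: "k \<le> n"
  shows "coeff (P n) k = - (coeff (P n) 0 / det_D \<nu> n) * det_Dk \<nu> n k"
proof (cases k)
  case 0
  then show ?thesis using det_D_nonzero[OF \<nu>, of n] by (simp add: det_Dk_def)
next
  case (Suc j)
  define a where "a = coeff (P n)"
  have j: "j < n" using k Suc by simp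
  have A: "f_matrix \<nu> n \<in> carrier_mat n n" by (simp add: f_matrix_def)
  have "f_matrix \<nu> n *\<^sub>v Matrix.vec n (\<lambda>j. a (Suc j)) = Matrix.vec n (\<lambda>m. - a 0 * coef_f \<nu> 0 m)"
  proof (rule eq_vecI)
    fix m assume "m < dim_vec (Matrix.vec n (\<lambda>m. - a 0 * coef_f \<nu> 0 m))"
    then have m: "m < n" by simp
    \<comment> \<open>The entries differ from moments only by a factor depending on the row, so
      orthogonality to \<open>x ^ m\<close> kills the row sum.\<close>
    have "(\<Sum>k\<le>n. a k * coef_f \<nu> k m) =
        (- 1) ^ m / (fact m * Gamma (\<nu> + 1)) * (\<Sum>k\<le>n. a k * rho_moment \<nu> (m + k))"
      by (simp add: coef_f_eq[OF \<nu>] sum_distrib_left sum_divide_distrib mult_ac)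
    also have "(\<Sum>k\<le>n. a k * rho_moment \<nu> (m + k)) = 0"
      unfolding a_def by (rule orthonormal_coeffs(1)[OF \<nu> deg lead orth m])
    finally have "a 0 * coef_f \<nu> 0 m + (\<Sum>j<n. a (Suc j) * coef_f \<nu> (Suc j) m) = 0"
      by (simp add: sum.atMost_shift)
    then show "vec_index (f_matrix \<nu> n *\<^sub>v Matrix.vec n (\<lambda>j. a (Suc j))) m =
        vec_index (Matrix.vec n (\<lambda>m. - a 0 * coef_f \<nu> 0 m)) m"
      using m by (simp add: f_matrix_def scalar_prod_def atLeast0LessThan mult.commute)
  qed (simp add: f_matrix_def)
  then have "a (Suc j) * det_D \<nu> n = - a 0 * det_Dk \<nu> n (Suc j)"
    using cramer_lemma_mat[OF A _ j, of "Matrix.vec n (\<lambda>j. a (Suc j))"] j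
      det_replace_col_smult[OF A j, of "- a 0" "coef_f \<nu> 0"]
    by (simp add: det_D_def det_Dk_def)
  then show ?thesis
    using det_D_nonzero[OF \<nu>, of n] by (simp add: Suc a_def field_simps)
qed

theorem theorem3:
  fixes \<nu> :: real and P :: "nat \<Rightarrow> real poly" and n :: nat
  assumes "\<nu> > - 1 / 2"
    and "\<And>m. degree (P m) = m"
    and "\<And>m. coeff (P m) m > 0"
    and "\<And>m l. (LBINT x:{0<..}. poly (P m) x * poly (P l) x * (rho \<nu> x)\<^sup>2) =
                 (if m = l then 1 else 0)"
  shows "det_D \<nu> n \<noteq> 0 \<and>
    det_Dk \<nu> n n * norm_S \<nu> n > 0 \<and>
    (\<exists>\<sigma>\<in>{1, -1}.
           coeff (P n) 0 = \<sigma> * det_D \<nu> n * (det_Dk \<nu> n n * norm_S \<nu> n) powr (- 1 / 2)) \<and>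
    (\<forall>x>0. poly (P n) x =
           - coeff (P n) 0 / (det_D \<nu> n * rho \<nu> x) *
           (\<Sum>r\<le>n. det_Dk \<nu> n r * fact r * pochhammer (1 + \<nu>) r *
              (\<Sum>k\<le>2 * r. 1 / fact k * (deriv ^^ k) (\<lambda>y. y ^ k * rho \<nu> y) x *
                 hypergeometric_F [- of_nat k, 1 + \<nu> + of_nat r, 1 + of_nat r] [1 + \<nu>, 1] 1)))"
proof -
  note \<nu> = assms(1)
  have \<nu>1: "\<nu> > - 1" using \<nu> by simp
  have orth: "moment_functional (rho_moment \<nu>) (P m * P l) = (if m = l then 1 else 0)" for m l
    using halfline_integral_eq[OF rho_moment_functional_integral[OF \<nu>, of "P m * P l"]] assms(4)[of m l]
    by simp
  \<comment> \<open>With this \<open>b\<close>, every coefficient of \<open>P n\<close> is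
    \<open>- b\<close> times the corresponding \<open>det_Dk\<close>.\<close>
  define D S b where "D = det_D \<nu> n" and "S = norm_S \<nu> n" and "b = coeff (P n) 0 / D"
  have D: "D \<noteq> 0" unfolding D_def by (rule det_D_nonzero[OF \<nu>])
  have coeff: "coeff (P n) k = - b * det_Dk \<nu> n k" if "k \<le> n" for k
    using orthonormal_coeff_det[OF assms(1-3) orth that] by (simp add: b_def D_def)
  have "1 / coeff (P n) n = - b * S"
    unfolding orthonormal_coeffs(2)[OF assms(1-3) orth, symmetric] S_def norm_S_eq[OF \<nu>] sum_distrib_left
    by (intro sum.cong refl) (simp add: coeff)
  \<comment> \<open>The leading coefficient is itself \<open>- b * det_Dk \<nu> n n\<close>, so
    multiplying by it turns the normalization into an equation for \<open>b\<^sup>2\<close>.\<close>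
  then have "b\<^sup>2 * (det_Dk \<nu> n n * S) = coeff (P n) n * (1 / coeff (P n) n)"
    using coeff[of n] by (simp add: power2_eq_square)
  also have "\<dots> = 1" using assms(3)[of n] by simp
  finally have eq1: "b\<^sup>2 * (det_Dk \<nu> n n * S) = 1" .
  then have pos: "det_Dk \<nu> n n * S > 0"
    using zero_less_mult_pos[of "b\<^sup>2" "det_Dk \<nu> n n * S"] by fastforce
  define c where "c = (det_Dk \<nu> n n * S) powr (- 1 / 2)"
  have "c\<^sup>2 = (det_Dk \<nu> n n * S) powr (- 1)"
    by (simp add: c_def power2_eq_square powr_add[symmetric])
  also have "\<dots> = b\<^sup>2"
    using eq1 pos powr_neg_one[OF pos] nonzero_eq_divide_eq[of "det_Dk \<nu> n n * S" "b\<^sup>2" 1]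
    by (metis less_irrefl)
  \<comment> \<open>Only \<open>b\<^sup>2\<close> is determined here; the remaining sign is the
    \<open>\<sigma>\<close> of the statement.\<close>
  finally have "b = c \<or> b = - c" by (auto simp: power2_eq_iff)
  then have "\<exists>\<sigma>\<in>{1, - 1}. coeff (P n) 0 = \<sigma> * D * c"
    using D by (auto simp: b_def field_simps)
  moreover have "poly (P n) x = - coeff (P n) 0 / (D * rho \<nu> x) *
           (\<Sum>r\<le>n. det_Dk \<nu> n r * fact r * pochhammer (1 + \<nu>) r *
              (\<Sum>k\<le>2 * r. 1 / fact k * (deriv ^^ k) (\<lambda>y. y ^ k * rho \<nu> y) x *
                 hypergeometric_F [- of_nat k, 1 + \<nu> + of_nat r, 1 + of_nat r] [1 + \<nu>, 1] 1))"
    (is "_ = _ * ?rhs") if x: "x > 0" for x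
  proof -
    \<comment> \<open>Each inner sum collapses to \<open>x ^ r * rho \<nu> x\<close>, after which
      \<open>rho\<close> cancels and the coefficients of \<open>P n\<close> are left.\<close>
    have "?rhs = (\<Sum>r\<le>n. det_Dk \<nu> n r * (x ^ r * rho \<nu> x))"
      unfolding power_rho_eq_hypergeometric_sum[OF \<nu>1 x, symmetric] by (simp only: mult.assoc)
    also have "\<dots> = rho \<nu> x * (\<Sum>r\<le>n. det_Dk \<nu> n r * x ^ r)"
      by (simp add: sum_distrib_left mult_ac)
    finally have "- coeff (P n) 0 / (D * rho \<nu> x) * ?rhs = - b * (\<Sum>r\<le>n. det_Dk \<nu> n r * x ^ r)"
      using rho_pos[OF x, of \<nu>] by (simp add: b_def)
    also have "\<dots> = (\<Sum>r\<le>n. coeff (P n) r * x ^ r)"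
      by (simp add: sum_distrib_left coeff mult.assoc)
    also have "\<dots> = poly (P n) x" by (simp add: poly_altdef assms(2))
    finally show ?thesis ..
  qed
  ultimately show ?thesis
    using D pos unfolding D_def S_def c_def by blast
qed

end
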